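(* Let $q$ be a prime power, $t\ge 1$, and $n_1,\dots,n_t$ non-negative integers; put $n=n_1+\cdots+n_t$. Let $k_1,\dots,k_t$ be integers. The set $\mathcal{M}(k_1,\dots,k_t;n_1,\dots,n_t)$ of subspaces of $\mathbb{F}_q^{n}$ of type $(k_1,\dots,k_t)$ is non-empty if and only if $$0\le k_i-k_{i+1}\le n_i\ (1\le i\le t-1)\quad\text{and}\quad 0\le k_t\le n_t.$$ Moreover, if these conditions hold, then $\mathcal{M}(k_1,\dots,k_t;n_1,\dots,n_t)$ is a single orbit of $GL_{n_1,\dots,n_t}(\mathbb{F}_q)$ and $$|\mathcal{M}(k_1,\dots,k_t;n_1,\dots,n_t)|=\begin{bmatrix} n_t\\ k_t\end{bmatrix}_q\prod_{j=1}^{t-1}q^{(k_j-k_{j+1})(n_{j+1}+\cdots+n_t-k_{j+1})}\begin{bmatrix} n_j\\ k_j-k_{j+1}\end{bmatrix}_q .$$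
   Context: $\mathbb{F}_q$ is the finite field with $q$ elements and $\mathbb{F}_q^{n}$ the space of row vectors. The $t$-singular general linear group $GL_{n_1,\dots,n_t}(\mathbb{F}_q)$ is the group of all nonsingular $n\times n$ matrices over $\mathbb{F}_q$ that are block upper triangular with respect to the partition $n=n_1+\cdots+n_t$ of rows and columns (i.e. blocks $T_{ij}$ of size $n_i\times n_j$, with $T_{ij}=0$ for $i>j$). It acts on $\mathbb{F}_q^n$ by right multiplication $x\mapsto xT$, and hence on subspaces, $P\mapsto PT$. For $1\le j\le n$ let $e_j$ be the $j$-th standard basis vector; for $2\le i\le t$ let $E_i$ be the subspace spanned by $e_{n_1+\cdots+n_{i-1}+1},\dots,e_n$ (dimension $n_i+\cdots+n_t$). A $k_1$-dimensional subspace $P$ of $\mathbb{F}_q^n$ is of type $(k_1,k_2,\dots,k_t)$ if $\dim(P\cap E_i)=k_i$ for each $2\le i\le t$. $\begin{bmatrix} a\\ b\end{bmatrix}_q$ denotes the Gaussian binomial coefficient. *)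

theory Defs
  imports
    "HOL-Library.Cardinality"
    "HOL-Algebra.Group_Action"
    "Jordan_Normal_Form.VS_Connect"
begin

text \<open>
  The block sizes \<open>n\<^sub>1, \<dots>, n\<^sub>t\<close> are \<open>ns 1, \<dots>, ns t\<close> and the type \<open>(k\<^sub>1, \<dots>, k\<^sub>t)\<close> is
  \<open>ks 1, \<dots>, ks t\<close>; values of \<open>ns\<close> and \<open>ks\<close> at other arguments are irrelevant.
  Rows, columns and coordinates are indexed from 0, so block \<open>i\<close> occupies the indices
  \<open>{block_start ns i..<block_start ns (i + 1)}\<close>.
\<close>

definition total_dim :: "nat \<Rightarrow> (nat \<Rightarrow> nat) \<Rightarrow> nat" where
  "total_dim t ns = (\<Sum>l = 1..t. ns l)"

definition block_start :: "(nat \<Rightarrow> nat) \<Rightarrow> nat \<Rightarrow> nat" where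
  "block_start ns i = (\<Sum>l = 1..<i. ns l)"

definition block_upper_triangular :: "nat \<Rightarrow> (nat \<Rightarrow> nat) \<Rightarrow> 'a :: zero mat \<Rightarrow> bool" where
  "block_upper_triangular t ns T \<longleftrightarrow>
     (\<forall>i \<in> {1..t}. \<forall>j \<in> {1..t}. j < i \<longrightarrow>
        (\<forall>r \<in> {block_start ns i..<block_start ns (i + 1)}.
         \<forall>c \<in> {block_start ns j..<block_start ns (j + 1)}. T $$ (r, c) = 0))"

definition singular_GL :: "nat \<Rightarrow> (nat \<Rightarrow> nat) \<Rightarrow> 'a :: field mat monoid" where
  "singular_GL t ns =
     \<lparr>carrier = {T \<in> carrier_mat (total_dim t ns) (total_dim t ns).
                   invertible_mat T \<and> block_upper_triangular t ns T},
      mult = (*), one = 1\<^sub>m (total_dim t ns)\<rparr>"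

definition row_mult :: "'a :: semiring_0 vec \<Rightarrow> 'a mat \<Rightarrow> 'a vec" where
  "row_mult x T = vec (dim_col T) (\<lambda>j. x \<bullet> col T j)"

text \<open>
  The action \<open>P \<mapsto> PT\<close>. It is a right action, so it is not a \<^locale>\<open>group_action\<close> as it stands;
  the constant \<^const>\<open>orbits\<close> only uses the set \<open>{PT | T \<in> G}\<close> and applies to it unchanged.
\<close>

definition subspace_mult :: "'a :: semiring_0 mat \<Rightarrow> 'a vec set \<Rightarrow> 'a vec set" where
  "subspace_mult T P = (\<lambda>x. row_mult x T) ` P"

definition vec_subspaces :: "nat \<Rightarrow> 'a :: field vec set set" where
  "vec_subspaces n = {P. VectorSpace.subspace class_ring P (module_vec TYPE('a) n)}"

definition vec_dim :: "nat \<Rightarrow> 'a :: field vec set \<Rightarrow> nat" where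
  "vec_dim n P = vectorspace.dim class_ring (module_vec TYPE('a) n\<lparr>carrier := P\<rparr>)"

definition flag_space :: "nat \<Rightarrow> (nat \<Rightarrow> nat) \<Rightarrow> nat \<Rightarrow> 'a :: field vec set" where
  "flag_space t ns i =
     LinearCombinations.module.span class_ring (module_vec TYPE('a) (total_dim t ns))
       (unit_vec (total_dim t ns) ` {block_start ns i..<total_dim t ns})"

definition subspaces_of_type ::
  "nat \<Rightarrow> (nat \<Rightarrow> int) \<Rightarrow> (nat \<Rightarrow> nat) \<Rightarrow> 'a :: field vec set set" where
  "subspaces_of_type t ks ns =
     {P \<in> vec_subspaces (total_dim t ns).
        int (vec_dim (total_dim t ns) P) = ks 1 \<and>
        (\<forall>i \<in> {2..t}. int (vec_dim (total_dim t ns) (P \<inter> flag_space t ns i)) = ks i)}"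

definition admissible_type :: "nat \<Rightarrow> (nat \<Rightarrow> int) \<Rightarrow> (nat \<Rightarrow> nat) \<Rightarrow> bool" where
  "admissible_type t ks ns \<longleftrightarrow>
     (\<forall>i \<in> {1..<t}. 0 \<le> ks i - ks (i + 1) \<and> ks i - ks (i + 1) \<le> int (ns i)) \<and>
     0 \<le> ks t \<and> ks t \<le> int (ns t)"

text \<open>
  The quotient form \<open>(q\<^sup>a - 1)(q\<^sup>a - q)\<cdots>(q\<^sup>a - q\<^sup>b\<^sup>-\<^sup>1) / ((q\<^sup>b - 1)(q\<^sup>b - q)\<cdots>(q\<^sup>b - q\<^sup>b\<^sup>-\<^sup>1))\<close>;
  no denominator vanishes when \<open>q \<ge> 2\<close>, and the value is 0 when \<open>b > a\<close>.
\<close>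

definition gauss_binomial :: "nat \<Rightarrow> nat \<Rightarrow> nat \<Rightarrow> rat" where
  "gauss_binomial q a b =
     (\<Prod>i<b. (of_nat q ^ a - of_nat q ^ i) / (of_nat q ^ b - of_nat q ^ i))"

end

(*
  Call j a pivot of a subspace P if P contains a vector whose first nonzero entry is at position j.
  The dimension of P is its number of pivots, and dim (P \<inter> E_i) is the number of pivots in the blocks
  from i on, so the type of P records exactly how many pivots lie in each block.

  Counting: if m is the smallest pivot, then P is determined by its intersection with the vectors
  vanishing at the positions 0, ..., m and by a vector with leading entry 1 at m, modulo that
  intersection.  So the number of subspaces with pivot set J is q^e, where e counts the pairs of a
  pivot and a later non-pivot.  The sum over all J with prescribed block counts factors over the
  blocks, and in one block the q-Pascal recursion yields a Gaussian binomial coefficient.  The count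
  is nonzero for admissible types, which gives existence.

  Transitivity: the vectors of P with leading entry 1 at its pivots, completed by unit vectors, are the
  rows of an upper unitriangular matrix; permuting its rows within the blocks gives a matrix that
  carries the coordinate subspace of any J with the same block counts to P.
*)
theory Submission
  imports Defs
begin

section \<open>Pivots of subspaces\<close>

text \<open>Unfolds the locale predicates once; from here on subspaces are plain sets with closure
  conditions. The scalar \<open>c\<close> ranges over the whole type because that is the carrier of
  \<open>class_ring\<close>.\<close>

lemma mem_vec_subspaces_iff:
  "P \<in> vec_subspaces n \<longleftrightarrow>
     P \<subseteq> carrier_vec n \<and> 0\<^sub>v n \<in> P \<and> (\<forall>x\<in>P. \<forall>y\<in>P. x + y \<in> P) \<and>
     (\<forall>c. \<forall>x\<in>P. c \<cdot>\<^sub>v x \<in> (P :: 'a :: field vec set))"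
proof -
  have "VectorSpace.subspace class_ring P (module_vec TYPE('a) n) \<longleftrightarrow>
        submodule class_ring P (module_vec TYPE('a) n)"
    by (auto simp: VectorSpace.subspace_def vec_vs)
  also have "\<dots> \<longleftrightarrow> P \<subseteq> carrier_vec n \<and> 0\<^sub>v n \<in> P \<and> (\<forall>x\<in>P. \<forall>y\<in>P. x + y \<in> P) \<and>
     (\<forall>c. \<forall>x\<in>P. c \<cdot>\<^sub>v x \<in> P)"
    by (auto simp: submodule_def vec_module module_vec_simps)
  finally show ?thesis
    by (simp add: vec_subspaces_def)
qed

lemma finite_carrier_vec [simp]: "finite (carrier_vec n :: 'a :: finite vec set)"
proof -
  have "carrier_vec n \<subseteq> vec_of_list ` {xs :: 'a list. set xs \<subseteq> UNIV \<and> length xs = n}"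
  proof
    fix v :: "'a vec" assume "v \<in> carrier_vec n"
    then show "v \<in> vec_of_list ` {xs. set xs \<subseteq> UNIV \<and> length xs = n}"
      by (intro image_eqI[of _ _ "list_of_vec v"]) (simp_all add: vec_list)
  qed
  then show ?thesis
    by (rule finite_subset) (intro finite_imageI finite_lists_length_eq finite_class.finite_UNIV)
qed

lemma finite_vec_subspace:
  "P \<in> vec_subspaces n \<Longrightarrow> finite (P :: 'a :: {field, finite} vec set)"
  by (meson finite_carrier_vec mem_vec_subspaces_iff rev_finite_subset)

text \<open>Linear combinations over a basis \<open>B\<close> give a bijection between the
  coefficient functions on \<open>B\<close> and \<open>P\<close>. Dimension thus becomes a matter of
  cardinality, which injective maps preserve.\<close>

lemma card_eq_power_vec_dim:
  fixes P :: "'a :: {field, finite} vec set"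
  assumes P: "P \<in> vec_subspaces n"
  shows "card P = CARD('a) ^ vec_dim n P"
proof -
  let ?W = "module_vec TYPE('a) n\<lparr>carrier := P\<rparr>"
  interpret vec_space "TYPE('a)" n .
  have sub: "VectorSpace.subspace class_ring P (module_vec TYPE('a) n)"
    using P by (simp add: vec_subspaces_def)
  interpret W: vectorspace class_ring ?W
    using subspace_is_vs[OF sub] .
  \<comment> \<open>\<open>P\<close> is a finite spanning set of itself, which gives finite
    dimension.\<close>
  have "finite P"
    using P by (rule finite_vec_subspace)
  moreover have "W.span P = P"
    using W.in_own_span[of P] W.span_is_subset2[of P] by auto
  ultimately have "W.fin_dim"
    unfolding W.fin_dim_def by (intro exI[of _ P]) auto
  then obtain B where B: "finite B" "W.basis B"
    using W.finite_basis_exists by blast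
  then have BP: "B \<subseteq> P"
    by (auto simp: W.basis_def)
  have "\<forall>v\<in>P. \<exists>!a. a \<in> B \<rightarrow>\<^sub>E UNIV \<and> W.lincomb a B = v"
    using W.basis_criterion[of B] B BP by (simp add: Ball_def)
  moreover have "W.lincomb a B \<in> P" for a
    using W.lincomb_closed[of B a] BP by simp
  ultimately have "bij_betw (\<lambda>a. W.lincomb a B) (B \<rightarrow>\<^sub>E UNIV) P"
    unfolding bij_betw_def inj_on_def image_def by (auto; blast)
  then have "card P = card (B \<rightarrow>\<^sub>E (UNIV :: 'a set))"
    by (simp add: bij_betw_same_card)
  also have "\<dots> = CARD('a) ^ card B"
    using B by (simp add: card_PiE)
  also have "card B = vec_dim n P"
    unfolding vec_dim_def using W.dim_basis B by simp
  finally show ?thesis .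
qed

text \<open>A tail for every position, not only for block starts, allows inductions that move one
  coordinate at a time. The guard \<open>i < n\<close> excludes indices beyond the vector, so the
  tail is zero once \<open>n \<le> m\<close>.\<close>

definition tail_space :: "nat \<Rightarrow> nat \<Rightarrow> 'a :: field vec set" where
  "tail_space n m = {v \<in> carrier_vec n. \<forall>i<m. i < n \<longrightarrow> v $ i = 0}"

text \<open>These are the columns of the leading entries in the reduced row echelon form of
  \<open>P\<close>.\<close>

definition pivots :: "nat \<Rightarrow> 'a :: field vec set \<Rightarrow> nat set" where
  "pivots n P = {j. j < n \<and> (\<exists>v\<in>P. v $ j \<noteq> 0 \<and> (\<forall>i<j. v $ i = 0))}"

lemma vec_subspacesD:
  assumes "P \<in> vec_subspaces n"
  shows "P \<subseteq> carrier_vec n" "0\<^sub>v n \<in> P" "\<And>x y. x \<in> P \<Longrightarrow> y \<in> P \<Longrightarrow> x + y \<in> P"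
    "\<And>c x. x \<in> P \<Longrightarrow> c \<cdot>\<^sub>v x \<in> P"
  using assms by (auto simp: mem_vec_subspaces_iff)

lemma vec_subspace_diff:
  assumes "P \<in> vec_subspaces n" "x \<in> P" "y \<in> P"
  shows "x - y \<in> P"
proof -
  have "x - y = x + (-1) \<cdot>\<^sub>v y"
    using assms vec_subspacesD(1)[OF assms(1)] by (intro eq_vecI) auto
  then show ?thesis
    using vec_subspacesD[OF assms(1)] assms by auto
qed

lemma vec_subspaces_Int:
  "P \<in> vec_subspaces n \<Longrightarrow> Q \<in> vec_subspaces n \<Longrightarrow> P \<inter> Q \<in> vec_subspaces n"
  by (auto simp: mem_vec_subspaces_iff)

lemma tail_space_subspace: "tail_space n m \<in> vec_subspaces n"
  by (auto simp: mem_vec_subspaces_iff tail_space_def)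

lemma tail_space_0 [simp]: "tail_space n 0 = carrier_vec n"
  by (simp add: tail_space_def)

lemma tail_space_Suc_iff:
  "m < n \<Longrightarrow> v \<in> tail_space n (Suc m) \<longleftrightarrow> v \<in> tail_space n m \<and> v $ m = 0"
  by (auto simp: tail_space_def less_Suc_eq)

lemma tail_space_top:
  assumes "n \<le> m"
  shows "tail_space n m = {0\<^sub>v n}"
  using assms by (auto simp: tail_space_def intro!: eq_vecI)

lemma finite_pivots [simp]: "finite (pivots n P)"
  by (rule finite_subset[of _ "{..<n}"]) (auto simp: pivots_def)

lemma pivots_less: "pivots n P \<subseteq> {0..<n}"
  by (auto simp: pivots_def)

text \<open>A vector with first nonzero entry at \<open>j\<close> lies in the tail from
  \<open>m\<close> exactly when \<open>m \<le> j\<close>. This turns the dimensions of the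
  intersections with the flag into pivot counts.\<close>

lemma pivots_Int_tail: "P \<subseteq> carrier_vec n \<Longrightarrow> pivots n (P \<inter> tail_space n m) = pivots n P \<inter> {m..}"
proof (intro equalityI subsetI)
  fix j assume "j \<in> pivots n (P \<inter> tail_space n m)"
  then obtain v where v: "j < n" "v \<in> P" "v \<in> tail_space n m" "v $ j \<noteq> 0" "\<forall>i<j. v $ i = 0"
    by (auto simp: pivots_def)
  then have "\<not> j < m"
    by (auto simp: tail_space_def)
  then show "j \<in> pivots n P \<inter> {m..}"
    using v by (auto simp: pivots_def)
next
  fix j assume "P \<subseteq> carrier_vec n" "j \<in> pivots n P \<inter> {m..}"
  then show "j \<in> pivots n (P \<inter> tail_space n m)"
    unfolding pivots_def tail_space_def by force
qed

lemma pivots_subset_tail: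
  assumes "P \<subseteq> tail_space n m"
  shows "pivots n P \<subseteq> {m..<n}"
proof -
  have "P \<subseteq> carrier_vec n" "P \<inter> tail_space n m = P"
    using assms by (auto simp: tail_space_def)
  then have "pivots n P \<subseteq> {m..}"
    using pivots_Int_tail[of P n m] by auto
  then show ?thesis
    using pivots_less by fastforce
qed

lemma subset_tail_Suc:
  assumes "P \<subseteq> tail_space n m" "m \<notin> pivots n P"
  shows "P \<subseteq> tail_space n (Suc m)"
  using assms unfolding tail_space_def pivots_def by (force simp: less_Suc_eq)

lemma pivot_vector:
  assumes P: "P \<in> vec_subspaces n" and j: "j \<in> pivots n P"
  obtains u where "u \<in> P" "u \<in> tail_space n j" "u $ j = 1"
proof -
  obtain v where v: "j < n" "v \<in> P" "v $ j \<noteq> 0" "\<forall>i<j. v $ i = 0"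
    using j by (auto simp: pivots_def)
  then have "v \<in> carrier_vec n"
    using vec_subspacesD(1)[OF P] by auto
  then show thesis
    using v vec_subspacesD(4)[OF P \<open>v \<in> P\<close>, of "inverse (v $ j)"]
    by (intro that[of "inverse (v $ j) \<cdot>\<^sub>v v"]) (auto simp: tail_space_def)
qed

section \<open>Adjoining a vector with leading entry 1 to a subspace of a later tail\<close>

definition line_plus :: "'a :: field vec \<Rightarrow> 'a vec set \<Rightarrow> 'a vec set" where
  "line_plus u Q = (\<lambda>(c, y). c \<cdot>\<^sub>v u + y) ` (UNIV \<times> Q)"

context
  fixes n m :: nat and u :: "'a :: field vec"
  assumes u: "u \<in> tail_space n m" "u $ m = 1" and m: "m < n"
begin

lemma leading_vec_carrier: "u \<in> carrier_vec n"
  using u by (simp add: tail_space_def)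

text \<open>Subtracting \<open>x $ m\<close> times \<open>u\<close> from \<open>x \<in> P\<close>
  clears coordinate \<open>m\<close>, so the difference lies in the next tail. For fixed
  \<open>u\<close>, this and \<open>line_plus_cut\<close> make cutting and adjoining mutually
  inverse.\<close>

lemma line_plus_Int_tail:
  assumes P: "P \<in> vec_subspaces n" "P \<subseteq> tail_space n m" "u \<in> P"
  shows "line_plus u (P \<inter> tail_space n (Suc m)) = P"
proof (intro equalityI subsetI)
  fix x assume "x \<in> line_plus u (P \<inter> tail_space n (Suc m))"
  then show "x \<in> P"
    using vec_subspacesD[OF P(1)] P(3) by (auto simp: line_plus_def)
next
  fix x assume x: "x \<in> P"
  define y where "y = x - x $ m \<cdot>\<^sub>v u"
  have xc: "x \<in> carrier_vec n"
    using x vec_subspacesD(1)[OF P(1)] by auto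
  have "y \<in> P"
    unfolding y_def using x P vec_subspacesD(4)[OF P(1)] by (intro vec_subspace_diff[OF P(1)])
  moreover have "y $ m = 0"
    using xc leading_vec_carrier u m by (simp add: y_def)
  ultimately have "y \<in> P \<inter> tail_space n (Suc m)"
    using P(2) m by (auto simp: tail_space_Suc_iff)
  moreover have "x = x $ m \<cdot>\<^sub>v u + y"
    using xc leading_vec_carrier by (intro eq_vecI) (auto simp: y_def)
  ultimately show "x \<in> line_plus u (P \<inter> tail_space n (Suc m))"
    unfolding line_plus_def by (intro image_eqI[of _ _ "(x $ m, y)"]) auto
qed

context
  fixes Q :: "'a vec set"
  assumes Q: "Q \<in> vec_subspaces n" "Q \<subseteq> tail_space n (Suc m)"
begin

lemma later_tail: "y \<in> Q \<Longrightarrow> y \<in> carrier_vec n \<and> y $ m = 0 \<and> y \<in> tail_space n m"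
  using Q m by (auto simp: tail_space_Suc_iff tail_space_def)

lemma line_plus_subspace: "line_plus u Q \<in> vec_subspaces n"
  unfolding mem_vec_subspaces_iff
proof (intro conjI ballI allI)
  show "line_plus u Q \<subseteq> carrier_vec n"
    using later_tail leading_vec_carrier by (auto simp: line_plus_def)
  have "0\<^sub>v n = 0 \<cdot>\<^sub>v u + 0\<^sub>v n"
    using leading_vec_carrier by (intro eq_vecI) auto
  then show "0\<^sub>v n \<in> line_plus u Q"
    using vec_subspacesD(2)[OF Q(1)] by (force simp: line_plus_def)
next
  fix x y assume "x \<in> line_plus u Q" "y \<in> line_plus u Q"
  then obtain c a d b where *: "x = c \<cdot>\<^sub>v u + a" "a \<in> Q" "y = d \<cdot>\<^sub>v u + b" "b \<in> Q"
    by (auto simp: line_plus_def)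
  then have "x + y = (c + d) \<cdot>\<^sub>v u + (a + b)"
    using later_tail[of a] later_tail[of b] leading_vec_carrier by (intro eq_vecI) (auto simp: algebra_simps)
  then show "x + y \<in> line_plus u Q"
    using * vec_subspacesD(3)[OF Q(1), of a b] unfolding line_plus_def
    by (intro image_eqI[of _ _ "(c + d, a + b)"]) auto
next
  fix d x assume "x \<in> line_plus u Q"
  then obtain c a where *: "x = c \<cdot>\<^sub>v u + a" "a \<in> Q"
    by (auto simp: line_plus_def)
  then have "d \<cdot>\<^sub>v x = (d * c) \<cdot>\<^sub>v u + d \<cdot>\<^sub>v a"
    using later_tail[of a] leading_vec_carrier by (intro eq_vecI) (auto simp: algebra_simps)
  then show "d \<cdot>\<^sub>v x \<in> line_plus u Q"
    using * vec_subspacesD(4)[OF Q(1), of a d] unfolding line_plus_def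
    by (intro image_eqI[of _ _ "(d * c, d \<cdot>\<^sub>v a)"]) auto
qed

lemma line_plus_subset_tail: "line_plus u Q \<subseteq> tail_space n m"
  using later_tail u
  by (auto simp: line_plus_def intro!: vec_subspacesD(3,4)[OF tail_space_subspace])

lemma mem_line_plus: "u \<in> line_plus u Q"
proof -
  have "u = 1 \<cdot>\<^sub>v u + 0\<^sub>v n"
    using leading_vec_carrier by (intro eq_vecI) auto
  then show ?thesis
    using vec_subspacesD(2)[OF Q(1)] unfolding line_plus_def
    by (intro image_eqI[of _ _ "(1, 0\<^sub>v n)"]) auto
qed

text \<open>Coordinate \<open>m\<close> of \<open>c \<cdot>\<^sub>v u + y\<close> is
  \<open>c\<close>, because \<open>y\<close> vanishes there; membership in the next tail therefore
  forces \<open>c = 0\<close>.\<close>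

lemma line_plus_cut: "line_plus u Q \<inter> tail_space n (Suc m) = Q"
proof (intro equalityI subsetI)
  fix x assume x: "x \<in> line_plus u Q \<inter> tail_space n (Suc m)"
  then obtain c y where *: "x = c \<cdot>\<^sub>v u + y" "y \<in> Q"
    by (auto simp: line_plus_def)
  have "x $ m = 0"
    using x m by (simp add: tail_space_Suc_iff)
  then have "c = 0"
    using * later_tail[of y]
        u leading_vec_carrier m by auto
  then have "x = y"
    using * later_tail[of y] leading_vec_carrier by (intro eq_vecI) auto
  then show "x \<in> Q"
    using * by simp
next
  fix x assume x: "x \<in> Q"
  then have "x = 0 \<cdot>\<^sub>v u + x"
    using later_tail[of x] leading_vec_carrier by (intro eq_vecI) auto
  then show "x \<in> line_plus u Q \<inter> tail_space n (Suc m)"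
    using x Q(2) unfolding line_plus_def by (auto intro!: image_eqI[of _ _ "(0, x)"])
qed

text \<open>Coordinate \<open>m\<close> of the sum recovers the scalar, and then the summand from
  \<open>Q\<close> is determined as well.\<close>

lemma card_line_plus: "card (line_plus u Q) = CARD('a) * card Q"
proof -
  have "inj_on (\<lambda>(c, y). c \<cdot>\<^sub>v u + y) (UNIV \<times> Q)"
  proof (rule inj_onI, clarsimp)
    fix c y d z assume *: "c \<cdot>\<^sub>v u + y = d \<cdot>\<^sub>v u + z" "y \<in> Q" "z \<in> Q"
    have "c = d"
      using arg_cong[OF *(1), of "\<lambda>v. v $ m"] *(2,3) later_tail[of y] later_tail[of z]
        u leading_vec_carrier m by auto
    moreover have "y $ i = z $ i" if "i < n" for i
      using arg_cong[OF *(1), of "\<lambda>v. v $ i"] *(2,3) later_tail[of y] later_tail[of z]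
        leading_vec_carrier that \<open>c = d\<close>
      by auto
    then have "y = z"
      using * later_tail[of y] later_tail[of z] by (intro eq_vecI) auto
    ultimately show "c = d \<and> y = z"
      by simp
  qed
  then show ?thesis
    by (simp add: line_plus_def card_image card_cartesian_product)
qed

end

end

lemma pivots_step:
  assumes P: "P \<subseteq> tail_space n m" and m: "m \<in> pivots n P"
  shows "pivots n P = insert m (pivots n (P \<inter> tail_space n (Suc m)))"
proof -
  have "P \<subseteq> carrier_vec n"
    using P by (auto simp: tail_space_def)
  then show ?thesis
    using pivots_subset_tail[OF P] m by (force simp: pivots_Int_tail)
qed

text \<open>Downward induction over the tails: if \<open>m\<close> is no pivot, \<open>P\<close>
  already lies in the next tail; otherwise \<open>P\<close> is \<open>CARD('a)\<close> times as
  large as its intersection with the next tail and has exactly one pivot more.\<close>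

lemma card_eq_power_pivots:
  fixes P :: "'a :: {field, finite} vec set"
  assumes P: "P \<in> vec_subspaces n"
  shows "card P = CARD('a) ^ card (pivots n P)"
proof -
  have *: "card P = CARD('a) ^ card (pivots n P)"
    if "m \<le> n" "P \<in> vec_subspaces n" "P \<subseteq> tail_space n m" for m and P :: "'a vec set"
    using that
  proof (induction m arbitrary: P rule: inc_induct)
    case base
    then have "P = {0\<^sub>v n}"
      using vec_subspacesD(2) by (auto simp: tail_space_top)
    then show ?case
      by (simp add: pivots_def cong: conj_cong)
  next
    case (step m)
    show ?case
    proof (cases "m \<in> pivots n P")
      case False
      then show ?thesis
        using step subset_tail_Suc by blast
    next
      case True
      obtain u where u: "u \<in> P" "u \<in> tail_space n m" "u $ m = 1"
        using pivot_vector[OF step.prems(1) True] .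
      let ?Q = "P \<inter> tail_space n (Suc m)"
      have Q: "?Q \<in> vec_subspaces n" "?Q \<subseteq> tail_space n (Suc m)"
        using step.prems by (auto intro!: vec_subspaces_Int tail_space_subspace)
      have "card P = CARD('a) * card ?Q"
        using card_line_plus[OF u(2,3) step.hyps(2) Q]
          line_plus_Int_tail[OF u(2,3) step.hyps(2) step.prems u(1)] by simp
      moreover have "m \<notin> pivots n ?Q"
        using pivots_subset_tail[OF Q(2)] by auto
      ultimately show ?thesis
        using step.IH[OF Q] pivots_step[OF step.prems(2) True] by simp
    qed
  qed
  show ?thesis
    using *[of 0 P] P vec_subspacesD(1)[OF P] by simp
qed

lemma CARD_field_ge_2: "CARD('a :: {field, finite}) \<ge> 2"
  using card_mono[of "UNIV :: 'a set" "{0, 1}"] by simp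

text \<open>Both numbers are the exponent of \<open>CARD('a)\<close> in \<open>card P\<close>, and
  the base is at least 2.\<close>

lemma vec_dim_eq_card_pivots:
  fixes P :: "'a :: {field, finite} vec set"
  assumes "P \<in> vec_subspaces n"
  shows "vec_dim n P = card (pivots n P)"
proof -
  have "CARD('a) ^ vec_dim n P = CARD('a) ^ card (pivots n P)"
    using card_eq_power_vec_dim[OF assms] card_eq_power_pivots[OF assms] by simp
  then show ?thesis
    using CARD_field_ge_2[where 'a = 'a] by (simp add: power_inject_exp)
qed

section \<open>Gaussian binomial coefficients and weights of pivot sets\<close>

text \<open>The number of reduced echelon matrices with pivot columns \<open>J\<close>: the row of
  pivot \<open>j\<close> has a free entry in each later column that is not a pivot.\<close>

definition cell_weight :: "nat \<Rightarrow> nat \<Rightarrow> nat set \<Rightarrow> nat" where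
  "cell_weight q n J = (\<Prod>j\<in>J. q ^ card ({j<..<n} - J))"

text \<open>Since \<open>a\<close> precedes all of \<open>B\<close>, it is not counted in any
  exponent belonging to \<open>B\<close>; only its own factor is new.\<close>

lemma cell_weight_insert:
  assumes B: "B \<subseteq> {a<..<n}"
  shows "cell_weight q n (insert a B) = q ^ card ({a<..<n} - B) * cell_weight q n B"
proof -
  have "finite B" "a \<notin> B"
    using B finite_subset by auto
  moreover have "(\<Prod>j\<in>B. q ^ card ({j<..<n} - insert a B)) = (\<Prod>j\<in>B. q ^ card ({j<..<n} - B))"
    using B by (intro prod.cong refl arg_cong[where f = "\<lambda>S. q ^ card S"]) auto
  moreover have "{a<..<n} - insert a B = {a<..<n} - B"
    by auto
  ultimately show ?thesis
    by (simp add: cell_weight_def)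
qed

lemma gauss_binomial_0 [simp]: "gauss_binomial q a 0 = 1"
  by (simp add: gauss_binomial_def)

text \<open>The numerator factor with index \<open>i = a\<close> vanishes.\<close>

lemma gauss_binomial_eq_0:
  assumes "a < b"
  shows "gauss_binomial q a b = 0"
  unfolding gauss_binomial_def using assms by (intro prod_zero bexI[of _ a]) auto

lemma gauss_binomial_neq_0:
  assumes "q \<ge> 2" "b \<le> a"
  shows "gauss_binomial q a b \<noteq> 0"
proof -
  have "rat_of_nat q ^ c \<noteq> rat_of_nat q ^ i" if "i < c" for i c
    using power_strict_increasing[OF that, of "rat_of_nat q"] assms by auto
  then show ?thesis
    using assms by (force simp: gauss_binomial_def)
qed

text \<open>One of the two q-Pascal rules. All three numerators are multiples of
  \<open>N m d\<close>, and after clearing denominators there remains \<open>(x ^ Suc m - 1) * x ^ d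
  = (x ^ m - x ^ d) + x ^ (m - d) * (x ^ Suc d - 1) * x ^ d\<close>.\<close>

lemma gauss_binomial_Suc_Suc:
  assumes q: "q \<ge> 2" and dm: "d \<le> m"
  shows "gauss_binomial q (Suc m) (Suc d) =
    gauss_binomial q m (Suc d) + rat_of_nat q ^ (m - d) * gauss_binomial q m d"
proof -
  define x where "x = rat_of_nat q"
  have x: "x > 1"
    using q by (simp add: x_def)
  define N where "N = (\<lambda>a b. \<Prod>i<b. x ^ a - x ^ i)"
  have G: "gauss_binomial q a b = N a b / N b b" for a b
    by (simp add: gauss_binomial_def N_def x_def prod_dividef)
  \<comment> \<open>The first factor is split off and a factor \<open>x\<close> is taken out of each
    of the others, which leaves \<open>N a d\<close>.\<close>
  have shift: "N (Suc a) (Suc d) = (x ^ Suc a - 1) * x ^ d * N a d" for a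
  proof -
    have "N (Suc a) (Suc d) = (x ^ Suc a - 1) * (\<Prod>i<d. x * (x ^ a - x ^ i))"
      unfolding N_def prod.lessThan_Suc_shift by (simp add: algebra_simps)
    then show ?thesis
      by (simp add: N_def prod.distrib)
  qed
  have last: "N m (Suc d) = N m d * (x ^ m - x ^ d)"
    by (simp add: N_def)
  have "x ^ c \<noteq> x ^ i" if "i < c" for i c
    using power_strict_increasing[OF that x] by auto
  then have N0: "N d d \<noteq> 0"
    by (force simp: N_def)
  have xd: "x ^ Suc d - 1 \<noteq> 0"
    using one_less_power[OF x, of "Suc d"] by simp
  have xm: "x ^ m = x ^ (m - d) * x ^ d"
    using dm by (simp flip: power_add)
  show ?thesis
    unfolding G shift last x_def[symmetric] using N0 xd x
    by (simp add: divide_simps) (simp add: xm algebra_simps)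
qed

text \<open>\<open>J\<close> holds the pivots behind the block and \<open>A\<close> those in it.
  Each pivot in \<open>A\<close> is paired with the \<open>n - b - card J\<close> non-pivots behind
  the block, which gives the power of \<open>q\<close>. The pairs inside the block give the Gaussian
  binomial by the q-Pascal rule, according to whether the first position \<open>a\<close> is a
  pivot.\<close>

lemma sum_cell_weight_block:
  assumes q: "q \<ge> 2" and J: "J \<subseteq> {b..<n}" and "a \<le> b" and bn: "b \<le> n"
  shows "(\<Sum>A | A \<subseteq> {a..<b} \<and> card A = c. rat_of_nat (cell_weight q n (A \<union> J))) =
    rat_of_nat (cell_weight q n J) * rat_of_nat q ^ (c * (n - b - card J)) *
      gauss_binomial q (b - a) c"
  using \<open>a \<le> b\<close>
proof (induction a arbitrary: c rule: inc_induct)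
  case base
  have "{A. A \<subseteq> {b..<b} \<and> card A = c} = (if c = 0 then {{}} else {})"
    by auto
  then show ?case
    by (simp add: gauss_binomial_eq_0)
next
  case (step a)
  let ?F = "\<lambda>a c. {A. A \<subseteq> {a..<b} \<and> card A = c}"
  let ?w = "\<lambda>A. rat_of_nat (cell_weight q n (A \<union> J))"
  define X where "X = n - b - card J"
  have fin: "finite (?F a c)" for a c
    by (rule finite_subset[of _ "Pow {a..<b}"]) auto
  have finJ: "finite J"
    using J finite_subset by blast
  have cJ: "card J \<le> n - b"
    using card_mono[OF _ J] by simp
  have ba: "b - a = Suc (b - Suc a)"
    using step.hyps by simp
  show ?case
  proof (cases c)
    case 0
    have "?F a 0 = {{}}"
      by (auto dest: finite_subset)
    then show ?thesis
      by (simp add: 0 del: Collect_conj_eq)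
  next
    case (Suc d)
    have ins: "{a..<b} = insert a {Suc a..<b}"
      using step.hyps by auto
    have split: "?F a c = ?F (Suc a) c \<union> insert a ` ?F (Suc a) d"
    proof (intro equalityI subsetI)
      fix A assume A: "A \<in> ?F a c"
      then have "finite A"
        using finite_subset[of A "{a..<b}"] by simp
      show "A \<in> ?F (Suc a) c \<union> insert a ` ?F (Suc a) d"
      proof (cases "a \<in> A")
        case True
        have "A - {a} \<subseteq> {Suc a..<b}"
          using A unfolding ins by blast
        then have "A - {a} \<in> ?F (Suc a) d"
          using A True \<open>finite A\<close> Suc by simp
        moreover have "A = insert a (A - {a})"
          using True by blast
        ultimately show ?thesis
          by (intro UnI2 image_eqI)
      next
        case False
        then have "A \<subseteq> {Suc a..<b}"
          using A unfolding ins by blast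
        then show ?thesis
          using A by simp
      qed
    next
      fix A assume "A \<in> ?F (Suc a) c \<union> insert a ` ?F (Suc a) d"
      then consider "A \<in> ?F (Suc a) c" | B where "A = insert a B" "B \<in> ?F (Suc a) d"
        by blast
      then show "A \<in> ?F a c"
      proof cases
        case 1
        then show ?thesis
          unfolding ins by blast
      next
        case 2
        then have "finite B" "a \<notin> B" "B \<subseteq> {a..<b}"
          unfolding ins using finite_subset[of B "{Suc a..<b}"] by (simp, auto)
        then show ?thesis
          using 2 Suc step.hyps by simp
      qed
    qed
    have disj: "?F (Suc a) c \<inter> insert a ` ?F (Suc a) d = {}"
      by auto
    have inj: "inj_on (insert a) (?F (Suc a) d)"
    proof (rule inj_onI)
      fix A B assume "A \<in> ?F (Suc a) d" "B \<in> ?F (Suc a) d" "insert a A = insert a B"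
      then have "a \<notin> A" "a \<notin> B" "insert a A = insert a B"
        by auto
      then show "A = B"
        by (simp add: insert_ident)
    qed
    \<comment> \<open>The non-pivots after \<open>a\<close> are \<open>X\<close> positions from
      \<open>b\<close> on and \<open>b - Suc a - d\<close> positions of the block.\<close>
    have w: "?w (insert a A) = rat_of_nat q ^ (X + (b - Suc a - d)) * ?w A"
      if A: "A \<in> ?F (Suc a) d" for A
    proof -
      have "finite A"
        using A finite_subset[of A "{Suc a..<b}"] by simp
      moreover have "A \<inter> J = {}"
        using A J by fastforce
      ultimately have AJ: "card (A \<union> J) = d + card J"
        using A finJ by (simp add: card_Un_disjoint)
      have sub: "A \<union> J \<subseteq> {a<..<n}"
        using A J bn step.hyps by fastforce
      have d: "d \<le> b - Suc a"
        using A card_mono[of "{Suc a..<b}" A] by auto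
      have "card ({a<..<n} - (A \<union> J)) = n - Suc a - (d + card J)"
        using sub AJ \<open>finite A\<close> finJ by (subst card_Diff_subset) auto
      also have "\<dots> = X + (b - Suc a - d)"
        using d cJ bn step.hyps by (simp add: X_def)
      finally show ?thesis
        using cell_weight_insert[OF sub, of q] by simp
    qed
    have "(\<Sum>A\<in>?F a c. ?w A) = (\<Sum>A\<in>?F (Suc a) c. ?w A) + (\<Sum>A\<in>?F (Suc a) d. ?w (insert a A))"
      unfolding split using fin disj by (simp add: sum.union_disjoint sum.reindex[OF inj])
    also have "(\<Sum>A\<in>?F (Suc a) d. ?w (insert a A)) =
        rat_of_nat q ^ (X + (b - Suc a - d)) * (\<Sum>A\<in>?F (Suc a) d. ?w A)"
      unfolding sum_distrib_left by (rule sum.cong[OF refl w])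
    finally have "(\<Sum>A\<in>?F a c. ?w A) = rat_of_nat (cell_weight q n J) * rat_of_nat q ^ (c * X) *
        (gauss_binomial q (b - Suc a) (Suc d) +
          rat_of_nat q ^ (b - Suc a - d) * gauss_binomial q (b - Suc a) d)"
      unfolding step.IH X_def[symmetric] by (simp add: Suc power_add algebra_simps)
    \<comment> \<open>If \<open>d\<close> exceeds \<open>b - Suc a\<close>, the subtraction in the
      exponent truncates, but all three coefficients vanish.\<close>
    also have "gauss_binomial q (b - Suc a) (Suc d) +
          rat_of_nat q ^ (b - Suc a - d) * gauss_binomial q (b - Suc a) d = gauss_binomial q (b - a) c"
    proof (cases "d \<le> b - Suc a")
      case True
      then show ?thesis
        using gauss_binomial_Suc_Suc[OF q True] by (simp add: Suc ba)
    next
      case False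
      then show ?thesis
        by (simp add: Suc ba gauss_binomial_eq_0)
    qed
    finally show ?thesis
      by (simp only: X_def)
  qed
qed

section \<open>Subspaces with a given pivot set\<close>

text \<open>The Schubert cell of \<open>J\<close> with respect to the flag of tail spaces.\<close>

definition cells :: "nat \<Rightarrow> nat set \<Rightarrow> 'a :: field vec set set" where
  "cells n J = {P \<in> vec_subspaces n. pivots n P = J}"

lemma finite_vec_subspaces: "finite (vec_subspaces n :: 'a :: {field, finite} vec set set)"
  by (rule finite_subset[of _ "Pow (carrier_vec n)"]) (auto simp: mem_vec_subspaces_iff)

lemma finite_cells [simp]: "finite (cells n J :: 'a :: {field, finite} vec set set)"
  by (rule finite_subset[OF _ finite_vec_subspaces]) (auto simp: cells_def)

text \<open>Walks up from position 0: no \<open>k < m\<close> is a pivot, so each such coordinate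
  vanishes on all of \<open>P\<close>.\<close>

lemma cells_subset_tail:
  assumes P: "P \<in> cells n J" and J: "J \<subseteq> {m..<n}" and mn: "m \<le> n"
  shows "P \<subseteq> tail_space n m"
proof -
  have "P \<subseteq> tail_space n k" if "k \<le> m" for k
    using that
  proof (induction k)
    case 0
    then show ?case
      using P by (simp add: cells_def mem_vec_subspaces_iff)
  next
    case (Suc k)
    then show ?case
      using P J by (intro subset_tail_Suc) (auto simp: cells_def)
  qed
  then show ?thesis
    by simp
qed

lemma card_tail_space:
  assumes "m \<le> n"
  shows "card (tail_space n m :: 'a :: {field, finite} vec set) = CARD('a) ^ (n - m)"
proof -
  have "j \<in> pivots n (tail_space n m :: 'a vec set)" if "m \<le> j" "j < n" for j
  proof -
    have "unit_vec n j \<in> (tail_space n m :: 'a vec set)"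
      using that by (auto simp: tail_space_def)
    then show ?thesis
      using that unfolding pivots_def by force
  qed
  then have "pivots n (tail_space n m :: 'a vec set) = {m..<n}"
    using pivots_subset_tail[of "tail_space n m :: 'a vec set" n m] by auto
  then show ?thesis
    using card_eq_power_pivots[OF tail_space_subspace[of n m, where 'a = 'a]] by simp
qed

text \<open>The slice is the translate by \<open>u\<close> of the intersection with the next
  tail.\<close>

lemma card_unit_slice:
  fixes u :: "'a :: {field, finite} vec"
  assumes P: "P \<in> vec_subspaces n" "P \<subseteq> tail_space n m" and m: "m < n"
    and u: "u \<in> P" "u $ m = 1"
  shows "card {v \<in> P. v $ m = 1} = card (P \<inter> tail_space n (Suc m))"
proof -
  have c: "v \<in> carrier_vec n" if "v \<in> P" for v
    using that vec_subspacesD(1)[OF P(1)] by auto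
  have "bij_betw (\<lambda>y. u + y) (P \<inter> tail_space n (Suc m)) {v \<in> P. v $ m = 1}"
  proof (rule bij_betw_byWitness[of _ "\<lambda>v. v - u"])
    show "\<forall>y\<in>P \<inter> tail_space n (Suc m). u + y - u = y"
    proof
      fix y assume "y \<in> P \<inter> tail_space n (Suc m)"
      then show "u + y - u = y"
        using c[OF u(1)] c[of y] by (intro eq_vecI) auto
    qed
    show "\<forall>v\<in>{v \<in> P. v $ m = 1}. u + (v - u) = v"
    proof
      fix v assume "v \<in> {v \<in> P. v $ m = 1}"
      then show "u + (v - u) = v"
        using c[OF u(1)] c[of v] by (intro eq_vecI) auto
    qed
    show "(\<lambda>y. u + y) ` (P \<inter> tail_space n (Suc m)) \<subseteq> {v \<in> P. v $ m = 1}"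
      using u m vec_subspacesD(3)[OF P(1)] c by (force simp: tail_space_Suc_iff)
    show "(\<lambda>v. v - u) ` {v \<in> P. v $ m = 1} \<subseteq> P \<inter> tail_space n (Suc m)"
      using u m vec_subspace_diff[OF P(1)] c P(2) by (force simp: tail_space_Suc_iff)
  qed
  then show ?thesis
    by (rule bij_betw_same_card[symmetric])
qed

text \<open>
  Both sides count the pairs \<open>(P, u)\<close> with \<open>u \<in> P\<close> normalised to have leading entry 1 at \<open>m\<close>:
  such a pair amounts to the pair \<open>(P \<inter> tail_space n (Suc m), u)\<close>.
\<close>

lemma card_cells_insert:
  assumes J: "J \<subseteq> {Suc m..<n}" and m: "m < n"
  shows "card (cells n (insert m J) :: 'a :: {field, finite} vec set set) * CARD('a) ^ card J =
    card (cells n J :: 'a vec set set) * CARD('a) ^ (n - Suc m)"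
proof -
  let ?U = "{u \<in> tail_space n m. u $ m = (1 :: 'a)}"
  let ?T = "tail_space n (Suc m) :: 'a vec set"
  let ?C = "cells n (insert m J) :: 'a vec set set"
  let ?D = "cells n J :: 'a vec set set"
  let ?slice = "\<lambda>P :: 'a vec set. {v \<in> P. v $ m = 1}"
  have mJ: "insert m J \<subseteq> {m..<n}"
    using J m by auto
  have C: "P \<in> vec_subspaces n" "P \<subseteq> tail_space n m" "m \<in> pivots n P"
    if "P \<in> ?C" for P
    using that cells_subset_tail[OF that mJ] m by (auto simp: cells_def)
  have cut: "P \<inter> ?T \<in> ?D" if "P \<in> ?C" for P
  proof -
    have "P \<subseteq> carrier_vec n"
      using C(1)[OF that] by (rule vec_subspacesD(1))
    then have "pivots n (P \<inter> ?T) = insert m J \<inter> {Suc m..}"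
      using that by (simp add: pivots_Int_tail cells_def)
    also have "\<dots> = J"
      using J by auto
    finally show ?thesis
      using C(1)[OF that] by (simp add: cells_def vec_subspaces_Int tail_space_subspace)
  qed
  have Q: "Q \<in> vec_subspaces n" "Q \<subseteq> ?T" if "Q \<in> ?D" for Q
    using that cells_subset_tail[OF that J] m by (auto simp: cells_def)
  have ext: "line_plus u Q \<in> ?C" if "Q \<in> ?D" "u \<in> ?U" for Q u
  proof -
    have u: "u \<in> tail_space n m" "u $ m = 1"
      using that by auto
    note Q = Q[OF that(1)]
    have "m \<in> pivots n (line_plus u Q)"
      using mem_line_plus[OF u m Q] u m unfolding pivots_def tail_space_def by force
    then have "pivots n (line_plus u Q) = insert m (pivots n Q)"
      using pivots_step[OF line_plus_subset_tail[OF u m Q]] line_plus_cut[OF u m Q] by simp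
    then show ?thesis
      using line_plus_subspace[OF u m Q] that by (simp add: cells_def)
  qed
  have "bij_betw (\<lambda>(P, u). (P \<inter> ?T, u)) (Sigma ?C ?slice) (?D \<times> ?U)"
  proof (rule bij_betw_byWitness[of _ "\<lambda>(Q, u). (line_plus u Q, u)"])
    show "\<forall>x\<in>Sigma ?C ?slice.
        (case case x of (P, u) \<Rightarrow> (P \<inter> ?T, u) of (Q, u) \<Rightarrow> (line_plus u Q, u)) = x"
      using line_plus_Int_tail[OF _ _ m] C by fastforce
    show "\<forall>x\<in>?D \<times> ?U.
        (case case x of (Q, u) \<Rightarrow> (line_plus u Q, u) of (P, u) \<Rightarrow> (P \<inter> ?T, u)) = x"
      using line_plus_cut[OF _ _ m] Q by fastforce
    show "(\<lambda>(P, u). (P \<inter> ?T, u)) ` Sigma ?C ?slice \<subseteq> ?D \<times> ?U"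
      using cut C(2) by fastforce
    show "(\<lambda>(Q, u). (line_plus u Q, u)) ` (?D \<times> ?U) \<subseteq> Sigma ?C ?slice"
      using ext mem_line_plus[OF _ _ m] Q by fastforce
  qed
  then have "card (Sigma ?C ?slice) = card (?D \<times> ?U)"
    by (rule bij_betw_same_card)
  moreover have "card (?slice P) = CARD('a) ^ card J" if "P \<in> ?C" for P
  proof -
    note P = C[OF that] and PT = cut[OF that]
    obtain u where "u \<in> P" "u $ m = 1"
      using pivot_vector[OF P(1,3)] by metis
    then have "card (?slice P) = card (P \<inter> ?T)"
      using card_unit_slice[OF P(1,2) m] by simp
    also have "\<dots> = CARD('a) ^ card J"
      using PT card_eq_power_pivots[of "P \<inter> ?T" n] by (simp add: cells_def)
    finally show ?thesis .
  qed
  moreover have "card ?U = CARD('a) ^ (n - Suc m)"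
  proof -
    \<comment> \<open>The same translation argument for the whole tail, with the unit vector at
      \<open>m\<close> as base point.\<close>
    have "card ?U = card (tail_space n m \<inter> ?T)"
      using m by (intro card_unit_slice[OF tail_space_subspace order.refl m, of "unit_vec n m"])
        (auto simp: tail_space_def)
    also have "tail_space n m \<inter> ?T = ?T"
      using m by (auto simp: tail_space_Suc_iff)
    finally show ?thesis
      using m by (simp add: card_tail_space)
  qed
  moreover have "finite (?slice P)" if "P \<in> ?C" for P
    using finite_vec_subspace[OF C(1)[OF that]] by simp
  ultimately show ?thesis
    by (simp add: card_SigmaI card_cartesian_product)
qed

text \<open>Induction on a lower bound \<open>m\<close> of the pivots, from \<open>n\<close>
  downwards; \<open>card_cells_insert\<close> and \<open>cell_weight_insert\<close> give matching
  recursions.\<close>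

lemma card_cells:
  assumes "J \<subseteq> {0..<n}"
  shows "card (cells n J :: 'a :: {field, finite} vec set set) = cell_weight CARD('a) n J"
proof -
  have "card (cells n J :: 'a vec set set) = cell_weight CARD('a) n J"
    if "m \<le> n" "J \<subseteq> {m..<n}" for m J
    using that
  proof (induction m arbitrary: J rule: inc_induct)
    case base
    have "cells n {} = {{0\<^sub>v n :: 'a vec}}"
    proof (intro equalityI subsetI)
      fix P :: "'a vec set" assume P: "P \<in> cells n {}"
      then have "P \<subseteq> {0\<^sub>v n}" "0\<^sub>v n \<in> P"
        using cells_subset_tail[OF P, of n] by (auto simp: tail_space_top cells_def mem_vec_subspaces_iff)
      then show "P \<in> {{0\<^sub>v n}}"
        by auto
    qed (auto simp: cells_def mem_vec_subspaces_iff pivots_def)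
    then show ?case
      using base by (simp add: cell_weight_def)
  next
    case (step m)
    have ins: "{m..<n} = insert m {Suc m..<n}"
      using step.hyps by auto
    show ?case
    proof (cases "m \<in> J")
      case False
      then show ?thesis
        using step.prems step.IH[of J] unfolding ins by blast
    next
      case True
      define J' where "J' = J - {m}"
      have J: "J = insert m J'" and J': "J' \<subseteq> {Suc m..<n}"
        using True step.prems unfolding ins J'_def by auto
      have J'': "J' \<subseteq> {m<..<n}"
        using J' by auto
      then have "finite J'" "card J' \<le> card {m<..<n}"
        by (simp_all only: card_mono finite_subset finite_greaterThanLessThan)
      \<comment> \<open>The positions after \<open>m\<close> split into pivots and the non-pivots
        counted by the weight; the power of \<open>CARD('a)\<close> that belongs to the pivots
        stands on both sides and cancels at the end.\<close>
      then have "n - Suc m = card J' + card ({m<..<n} - J')"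
        using J'' by (simp add: card_Diff_subset)
      then have "card (cells n J :: 'a vec set set) * CARD('a) ^ card J' =
          cell_weight CARD('a) n J * CARD('a) ^ card J'"
        using card_cells_insert[OF J' step.hyps(2), where 'a = 'a] step.IH[OF J']
          cell_weight_insert[OF J'', of "CARD('a)"]
        by (simp add: J power_add mult_ac)
      then show ?thesis
        by simp
    qed
  qed
  then show ?thesis
    using assms by blast
qed

section \<open>The flag spaces as coordinate tails\<close>

lemma in_span_unit_vecs:
  fixes v :: "'a :: field vec"
  assumes "m \<le> n" "v \<in> tail_space n m"
  shows "v \<in> LinearCombinations.module.span class_ring (module_vec TYPE('a) n) (unit_vec n ` {m..<n})"
  using assms
proof (induction m arbitrary: v rule: inc_induct)
  interpret vec_space "TYPE('a)" n .
  case base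
  then show ?case
    using span_zero by (simp add: tail_space_top)
next
  interpret vec_space "TYPE('a)" n .
  case (step m)
  let ?S = "unit_vec n ` {m..<n} :: 'a vec set"
  let ?w = "v - v $ m \<cdot>\<^sub>v unit_vec n m"
  have v: "v \<in> carrier_vec n"
    using step.prems by (simp add: tail_space_def)
  have S: "?S \<subseteq> carrier_vec n"
    by auto
  \<comment> \<open>Coordinate \<open>m\<close> is removed, so the rest is spanned by the later unit
    vectors.\<close>
  have "?w \<in> tail_space n (Suc m)"
    using step.prems step.hyps v by (auto simp: tail_space_def less_Suc_eq)
  then have "?w \<in> span (unit_vec n ` {Suc m..<n})"
    by (rule step.IH)
  moreover have "span (unit_vec n ` {Suc m..<n}) \<subseteq> span ?S"
    by (rule span_is_monotone) auto
  ultimately have "?w \<in> span ?S"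
    by blast
  moreover have "v $ m \<cdot>\<^sub>v unit_vec n m \<in> span ?S"
    using step.hyps S by (intro smult_in_span span_mem) auto
  moreover have "v = v $ m \<cdot>\<^sub>v unit_vec n m + ?w"
    using v by (intro eq_vecI) auto
  ultimately show ?case
    using span_add1[OF S] by metis
qed

text \<open>The unit vectors from the block start on lie in the tail, which is a subspace; the
  converse inclusion is \<open>in_span_unit_vecs\<close>.\<close>

lemma flag_space_eq_tail_space:
  assumes "block_start ns i \<le> total_dim t ns"
  shows "flag_space t ns i = tail_space (total_dim t ns) (block_start ns i)"
proof -
  interpret vec_space "TYPE('a)" "total_dim t ns" .
  let ?n = "total_dim t ns" and ?s = "block_start ns i"
  have "VectorSpace.subspace class_ring (tail_space ?n ?s) V"
    using tail_space_subspace[of ?n ?s] by (simp add: vec_subspaces_def)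
  then have "submodule class_ring (tail_space ?n ?s) V"
    by (simp add: VectorSpace.subspace_def)
  then have "span (unit_vec ?n ` {?s..<?n}) \<subseteq> tail_space ?n ?s"
    by (rule span_is_subset[rotated]) (auto simp: tail_space_def)
  then show ?thesis
    unfolding flag_space_def using in_span_unit_vecs[OF assms] by blast
qed

section \<open>Pivots and the block structure\<close>

lemma block_start_1 [simp]: "block_start ns (Suc 0) = 0"
  by (simp add: block_start_def)

lemma block_start_Suc: "1 \<le> i \<Longrightarrow> block_start ns (Suc i) = block_start ns i + ns i"
  by (simp add: block_start_def)

lemma block_start_top: "block_start ns (Suc t) = total_dim t ns"
  by (simp add: block_start_def total_dim_def atLeastLessThanSuc_atLeastAtMost)

lemma block_start_mono: "i \<le> j \<Longrightarrow> block_start ns i \<le> block_start ns j"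
  unfolding block_start_def by (intro sum_mono2) auto

lemma block_start_le_total_dim: "i \<le> Suc t \<Longrightarrow> block_start ns i \<le> total_dim t ns"
  using block_start_mono[of i "Suc t" ns] by (simp add: block_start_top)

lemma total_dim_minus_block_start:
  assumes "1 \<le> i" "i \<le> Suc t"
  shows "total_dim t ns - block_start ns i = (\<Sum>l = i..t. ns l)"
proof -
  have "{1..t} = {1..<i} \<union> {i..t}"
    using assms by auto
  moreover have "{1..<i} \<inter> {i..t} = {}"
    by auto
  ultimately have "total_dim t ns = block_start ns i + (\<Sum>l = i..t. ns l)"
    unfolding total_dim_def block_start_def by (simp only: sum.union_disjoint finite_atLeastAtMost
        finite_atLeastLessThan)
  then show ?thesis
    by simp
qed

text \<open>The pivot sets that the type allows on the blocks from \<open>i\<close> on. The case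
  \<open>i = 1\<close> concerns whole subspaces; the others serve the recursion over the
  blocks.\<close>

definition pivot_type :: "nat \<Rightarrow> (nat \<Rightarrow> int) \<Rightarrow> (nat \<Rightarrow> nat) \<Rightarrow> nat \<Rightarrow> nat set set" where
  "pivot_type t ks ns i = {J. J \<subseteq> {block_start ns i..<total_dim t ns} \<and>
     (\<forall>l\<in>{i..t}. int (card (J \<inter> {block_start ns l..})) = ks l)}"

text \<open>At index 1 the condition of \<open>pivot_type\<close> counts all pivots, which is the
  condition on the dimension of the subspace itself.\<close>

lemma subspaces_of_type_eq:
  assumes "t \<ge> 1"
  shows "(subspaces_of_type t ks ns :: 'a :: {field, finite} vec set set) =
    {P \<in> vec_subspaces (total_dim t ns). pivots (total_dim t ns) P \<in> pivot_type t ks ns 1}"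
proof -
  let ?n = "total_dim t ns"
  have "vec_dim ?n (P \<inter> flag_space t ns i) = card (pivots ?n P \<inter> {block_start ns i..})"
    if "P \<in> vec_subspaces ?n" "i \<le> t" for P :: "'a vec set" and i
    using that vec_subspacesD(1)[OF that(1)] block_start_le_total_dim[of i t ns]
    by (simp add: flag_space_eq_tail_space vec_dim_eq_card_pivots vec_subspaces_Int
        tail_space_subspace pivots_Int_tail)
  moreover have "{1..t} = insert 1 {2..t}"
    using assms by auto
  moreover have "{0..} = (UNIV :: nat set)"
    by auto
  ultimately show ?thesis
    by (auto simp: subspaces_of_type_def pivot_type_def vec_dim_eq_card_pivots
        dest!: pivots_less[THEN subsetD])
qed

text \<open>The subspaces of a type are the disjoint union of the cells of the allowed pivot
  sets.\<close>

lemma card_subspaces_of_type: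
  assumes "t \<ge> 1"
  shows "card (subspaces_of_type t ks ns :: 'a :: {field, finite} vec set set) =
    (\<Sum>J\<in>pivot_type t ks ns 1. cell_weight CARD('a) (total_dim t ns) J)"
proof -
  let ?n = "total_dim t ns"
  have fin: "finite (pivot_type t ks ns 1)"
    by (rule finite_subset[of _ "Pow {0..<?n}"]) (auto simp: pivot_type_def)
  have "(subspaces_of_type t ks ns :: 'a vec set set) = (\<Union>J\<in>pivot_type t ks ns 1. cells ?n J)"
    using assms by (auto simp: subspaces_of_type_eq cells_def)
  also have "card \<dots> = (\<Sum>J\<in>pivot_type t ks ns 1. card (cells ?n J :: 'a vec set set))"
    using fin by (intro card_UN_disjoint ballI finite_cells impI) (auto simp: cells_def)
  also have "\<dots> = (\<Sum>J\<in>pivot_type t ks ns 1. cell_weight CARD('a) ?n J)"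
    by (intro sum.cong refl card_cells) (auto simp: pivot_type_def)
  finally show ?thesis .
qed

lemma card_Int_block:
  fixes J :: "nat set"
  assumes "J \<subseteq> {0..<n}" "a \<le> b"
  shows "card (J \<inter> {a..}) = card (J \<inter> {a..<b}) + card (J \<inter> {b..})"
proof -
  have "finite J"
    using assms(1) by (rule finite_subset) simp
  moreover have "J \<inter> {a..} = (J \<inter> {a..<b}) \<union> (J \<inter> {b..})"
    using assms(2) by auto
  moreover have "(J \<inter> {a..<b}) \<inter> (J \<inter> {b..}) = {}"
    by auto
  ultimately show ?thesis
    by (simp add: card_Un_disjoint)
qed

text \<open>The difference of consecutive \<open>ks\<close> counts the pivots in one block, and
  block \<open>i\<close> has only \<open>ns i\<close> positions.\<close>

lemma admissible_if_pivot_type: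
  assumes "t \<ge> 1" "J \<in> pivot_type t ks ns 1"
  shows "admissible_type t ks ns"
proof -
  let ?s = "block_start ns"
  have J: "J \<subseteq> {0..<total_dim t ns}"
    using assms by (simp add: pivot_type_def)
  have ks: "int (card (J \<inter> {?s l..})) = ks l" if "1 \<le> l" "l \<le> t" for l
    using assms that by (simp add: pivot_type_def)
  have blk: "card (J \<inter> {?s l..}) = card (J \<inter> {?s l..<?s (Suc l)}) + card (J \<inter> {?s (Suc l)..})" for l
    using J by (rule card_Int_block) (simp add: block_start_mono)
  have le: "card (J \<inter> {?s l..<?s (Suc l)}) \<le> ns l" if "1 \<le> l" for l
    using card_mono[of "{?s l..<?s (Suc l)}" "J \<inter> {?s l..<?s (Suc l)}"] that
    by (simp add: block_start_Suc)
  \<comment> \<open>No pivot lies behind the last block, so \<open>ks t\<close> is itself the count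
    for block \<open>t\<close>.\<close>
  have "J \<inter> {?s (Suc t)..} = {}"
    using J by (auto simp: block_start_top)
  then have "0 \<le> ks t \<and> ks t \<le> int (ns t)"
    using ks[of t] blk[of t] le[of t] assms(1) by simp
  moreover have "0 \<le> ks i - ks (i + 1) \<and> ks i - ks (i + 1) \<le> int (ns i)" if "i \<in> {1..<t}" for i
    using ks[of i] ks[of "Suc i"] blk[of i] le[of i] that by simp
  ultimately show ?thesis
    by (simp add: admissible_type_def)
qed

text \<open>A pivot set splits uniquely into its part in block \<open>i\<close> and its part in the
  later blocks. By \<open>sum_cell_weight_block\<close> the sum over the former depends on the
  latter only through its weight and its size; the size is always \<open>ks (i + 1)\<close>, so the
  remaining factor comes out of the sum.\<close>

lemma sum_pivot_type_step:
  assumes adm: "admissible_type t ks ns" and i: "1 \<le> i" "i < t" and q: "q \<ge> 2"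
  shows "(\<Sum>J\<in>pivot_type t ks ns i. rat_of_nat (cell_weight q (total_dim t ns) J)) =
    rat_of_nat q powi ((ks i - ks (i + 1)) * (int (\<Sum>l = i + 1..t. ns l) - ks (i + 1))) *
    gauss_binomial q (ns i) (nat (ks i - ks (i + 1))) *
    (\<Sum>J\<in>pivot_type t ks ns (Suc i). rat_of_nat (cell_weight q (total_dim t ns) J))"
proof -
  let ?n = "total_dim t ns" and ?a = "block_start ns i" and ?b = "block_start ns (Suc i)"
  define c where "c = nat (ks i - ks (i + 1))"
  let ?B = "{A. A \<subseteq> {?a..<?b} \<and> card A = c}"
  have c: "int c = ks i - ks (i + 1)"
    using adm i by (auto simp: c_def admissible_type_def)
  have ab: "?a \<le> ?b" and bn: "?b \<le> ?n" and ban: "?b - ?a = ns i"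
    using i block_start_mono[of i "Suc i" ns] block_start_le_total_dim[of "Suc i" t ns]
    by (simp_all add: block_start_Suc)
  have bl: "?b \<le> block_start ns l" if "Suc i \<le> l" for l
    using that by (rule block_start_mono)
  have card_J: "int (card J) = ks (Suc i)" if "J \<in> pivot_type t ks ns (Suc i)" for J
  proof -
    have "J \<inter> {?b..} = J"
      using that by (auto simp: pivot_type_def)
    then show ?thesis
      using that i by (auto simp: pivot_type_def dest!: bspec[of _ _ "Suc i"])
  qed
  have split: "J \<in> pivot_type t ks ns i \<longleftrightarrow>
      J \<subseteq> {?a..<?n} \<and> J \<inter> {?b..} \<in> pivot_type t ks ns (Suc i) \<and> J \<inter> {..<?b} \<in> ?B" for J
  proof (cases "J \<subseteq> {?a..<?n}")
    case True
    have "J \<inter> {?b..} \<inter> {block_start ns l..} = J \<inter> {block_start ns l..}" if "Suc i \<le> l" for l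
      using bl[OF that] by auto
    moreover have "J \<inter> {?a..<?b} = J \<inter> {..<?b}" "J \<subseteq> {0..<?n}"
      using True by auto
    moreover have "{i..t} = insert i {Suc i..t}"
      using i by auto
    moreover have "J \<inter> {?b..} \<subseteq> {?b..<?n}" "J \<inter> {..<?b} \<subseteq> {?a..<?b}"
      using True by auto
    ultimately show ?thesis
      using True card_Int_block[of J ?n ?a ?b] ab c i
        card_J[of "J \<inter> {?b..}"]
      by (auto simp: pivot_type_def)
  next
    case False
    then show ?thesis
      by (auto simp: pivot_type_def)
  qed
  let ?w = "\<lambda>J. rat_of_nat (cell_weight q ?n J)"
  \<comment> \<open>In the pairs, \<open>J\<close> is the part in the later blocks and
    \<open>A\<close> the part in block \<open>i\<close>.\<close>
  have "(\<Sum>J\<in>pivot_type t ks ns i. ?w J) =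
      (\<Sum>(J, A)\<in>pivot_type t ks ns (Suc i) \<times> ?B. ?w (A \<union> J))"
  proof (rule sum.reindex_bij_witness[where i = "\<lambda>(J, A). A \<union> J"
        and j = "\<lambda>J. (J \<inter> {?b..}, J \<inter> {..<?b})"])
    fix J assume J: "J \<in> pivot_type t ks ns i"
    show "(case (J \<inter> {?b..}, J \<inter> {..<?b}) of (J, A) \<Rightarrow> A \<union> J) = J"
      by auto
    then show "(case (J \<inter> {?b..}, J \<inter> {..<?b}) of (J, A) \<Rightarrow> ?w (A \<union> J)) = ?w J"
      by simp
    show "(J \<inter> {?b..}, J \<inter> {..<?b}) \<in> pivot_type t ks ns (Suc i) \<times> ?B"
      using J split by blast
  next
    fix x assume x: "x \<in> pivot_type t ks ns (Suc i) \<times> ?B"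
    obtain J A where [simp]: "x = (J, A)"
      by fastforce
    have JA: "J \<subseteq> {?b..<?n}" "A \<subseteq> {?a..<?b}"
      using x by (auto simp: pivot_type_def)
    then have eq: "(A \<union> J) \<inter> {?b..} = J" "(A \<union> J) \<inter> {..<?b} = A"
      by fastforce+
    then show "((case x of (J, A) \<Rightarrow> A \<union> J) \<inter> {?b..}, (case x of (J, A) \<Rightarrow> A \<union> J) \<inter> {..<?b}) = x"
      by simp
    have "A \<union> J \<subseteq> {?a..<?n}"
      using JA ab bn by fastforce
    then show "(case x of (J, A) \<Rightarrow> A \<union> J) \<in> pivot_type t ks ns i"
      using x unfolding split by (simp add: eq)
  qed
  also have "\<dots> = (\<Sum>J\<in>pivot_type t ks ns (Suc i). \<Sum>A\<in>?B. ?w (A \<union> J))"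
    by (simp add: sum.cartesian_product)
  also have "\<dots> = (\<Sum>J\<in>pivot_type t ks ns (Suc i). ?w J *
      (rat_of_nat q powi ((ks i - ks (i + 1)) * (int (\<Sum>l = i + 1..t. ns l) - ks (i + 1))) *
       gauss_binomial q (ns i) c))"
  proof (rule sum.cong[OF refl])
    fix J assume J: "J \<in> pivot_type t ks ns (Suc i)"
    then have Jb: "J \<subseteq> {?b..<?n}"
      by (simp add: pivot_type_def)
    have nb: "?n - ?b = (\<Sum>l = i + 1..t. ns l)"
      using total_dim_minus_block_start[of "Suc i" t ns] i by simp
    \<comment> \<open>With \<open>c\<close> a natural number and \<open>J\<close> inside the later
      blocks, the integer exponent is a natural number and \<open>powi\<close> an ordinary
      power.\<close>
    have "card J \<le> ?n - ?b"
      using card_mono[OF _ Jb] by simp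
    then have "(ks i - ks (i + 1)) * (int (\<Sum>l = i + 1..t. ns l) - ks (i + 1)) =
        int (c * (?n - ?b - card J))"
      using card_J[OF J] c nb by (simp add: of_nat_diff)
    then show "(\<Sum>A\<in>?B. ?w (A \<union> J)) = ?w J *
      (rat_of_nat q powi ((ks i - ks (i + 1)) * (int (\<Sum>l = i + 1..t. ns l) - ks (i + 1))) *
       gauss_binomial q (ns i) c)"
      using sum_cell_weight_block[OF q Jb ab bn, of c] by (simp only: ban power_int_of_nat mult.assoc)
  qed
  also have "\<dots> = rat_of_nat q powi ((ks i - ks (i + 1)) * (int (\<Sum>l = i + 1..t. ns l) - ks (i + 1))) *
    gauss_binomial q (ns i) c * (\<Sum>J\<in>pivot_type t ks ns (Suc i). ?w J)"
    unfolding sum_distrib_right[symmetric] by (rule mult.commute)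
  finally show ?thesis
    by (simp only: c_def)
qed

lemma sum_pivot_type:
  assumes adm: "admissible_type t ks ns" and i: "1 \<le> i" "i \<le> t" and q: "q \<ge> 2"
  shows "(\<Sum>J\<in>pivot_type t ks ns i. rat_of_nat (cell_weight q (total_dim t ns) J)) =
    gauss_binomial q (ns t) (nat (ks t)) *
    (\<Prod>j = i..<t.
       rat_of_nat q powi ((ks j - ks (j + 1)) * (int (\<Sum>l = j + 1..t. ns l) - ks (j + 1))) *
       gauss_binomial q (ns j) (nat (ks j - ks (j + 1))))"
  using i(2,1)
proof (induction i rule: inc_induct)
  case base
  let ?n = "total_dim t ns" and ?a = "block_start ns t"
  have n: "?n = ?a + ns t"
    using block_start_Suc[of t ns] base by (simp add: block_start_top)
  have kt: "int (nat (ks t)) = ks t"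
    using adm by (simp add: admissible_type_def)
  have "J \<inter> {?a..} = J" if "J \<subseteq> {?a..<?n}" for J
    using that by auto
  then have "pivot_type t ks ns t = {A. A \<subseteq> {?a..<?n} \<and> card A = nat (ks t)}"
    using kt by (auto simp: pivot_type_def)
  \<comment> \<open>Nothing lies behind the last block: with \<open>J\<close> empty and
    \<open>b = n\<close> the power of \<open>q\<close> is 1.\<close>
  then show ?case
    using sum_cell_weight_block[OF q, of "{}" ?n ?n ?a "nat (ks t)"] n
    by (simp add: cell_weight_def)
next
  case (step i)
  then show ?case
    using sum_pivot_type_step[OF adm _ _ q, of i]
    by (simp add: prod.atLeast_Suc_lessThan mult_ac)
qed

section \<open>Transitivity of the group action\<close>

text \<open>Taking the least index skips empty blocks, whose start coincides with the next
  one.\<close>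

definition block_index :: "(nat \<Rightarrow> nat) \<Rightarrow> nat \<Rightarrow> nat" where
  "block_index ns r = (LEAST i. r < block_start ns (Suc i))"

lemma block_index_eqI:
  assumes "1 \<le> i" "block_start ns i \<le> r" "r < block_start ns (Suc i)"
  shows "block_index ns r = i"
  unfolding block_index_def
proof (rule Least_equality)
  fix k assume "r < block_start ns (Suc k)"
  then show "i \<le> k"
    using assms(2) block_start_mono[of "Suc k" i ns] by (cases "i \<le> k") auto
qed (use assms in auto)

lemma block_index_bounds:
  assumes "r < total_dim t ns"
  shows "1 \<le> block_index ns r" "block_index ns r \<le> t"
    "block_start ns (block_index ns r) \<le> r" "r < block_start ns (Suc (block_index ns r))"
proof -
  let ?k = "block_index ns r"
  have t: "r < block_start ns (Suc t)"
    using assms by (simp add: block_start_top)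
  show up: "r < block_start ns (Suc ?k)"
    unfolding block_index_def by (rule LeastI[of _ t]) (rule t)
  show "?k \<le> t"
    unfolding block_index_def by (rule Least_le) (rule t)
  show pos: "1 \<le> ?k"
    using up by (cases ?k) auto
  have "\<not> r < block_start ns (Suc (?k - 1))"
    unfolding block_index_def by (rule not_less_Least) (use pos in \<open>simp add: block_index_def\<close>)
  then show "block_start ns ?k \<le> r"
    using pos by simp
qed

text \<open>Label each position by its block and by membership in the pivot set. Equal pivot counts
  per block force equal non-pivot counts, so the two labellings have the same multiset of values and
  differ by a permutation of the positions.\<close>

lemma ex_block_permutation:
  assumes J: "J \<in> pivot_type t ks ns 1" and J': "J' \<in> pivot_type t ks ns 1"
  obtains p where "p permutes {0..<total_dim t ns}"
    "\<And>r. r < total_dim t ns \<Longrightarrow> p r \<in> J' \<longleftrightarrow> r \<in> J"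
    "\<And>r. r < total_dim t ns \<Longrightarrow> block_index ns (p r) = block_index ns r"
proof -
  let ?A = "{0..<total_dim t ns}" and ?f = "block_index ns"
  have JA: "J \<subseteq> ?A" "J' \<subseteq> ?A"
    using J J' by (simp_all add: pivot_type_def)
  have block: "{x \<in> K. ?f x = l} =
      (if l \<in> {1..t} then K \<inter> {block_start ns l..<block_start ns (Suc l)} else {})"
    if "K \<subseteq> ?A" for K l
  proof (cases "l \<in> {1..t}")
    case True
    have "?f x = l \<longleftrightarrow> x \<in> {block_start ns l..<block_start ns (Suc l)}" if "x \<in> K" for x
      using block_index_bounds(3,4)[of x t ns] block_index_eqI[of l ns x] \<open>K \<subseteq> ?A\<close> that True
      by auto
    then have "{x \<in> K. ?f x = l} = K \<inter> {block_start ns l..<block_start ns (Suc l)}"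
      by blast
    then show ?thesis
      using True by simp
  next
    case False
    have "?f x \<noteq> l" if "x \<in> K" for x
      using block_index_bounds(1,2)[of x t ns] \<open>K \<subseteq> ?A\<close> that False by auto
    then show ?thesis
      using False by auto
  qed
  have fib: "card {x \<in> J. ?f x = l} = card {x \<in> J'. ?f x = l}" for l
  proof (cases "l \<in> {1..t}")
    case True
    \<comment> \<open>There are no pivots behind the last block, hence the value 0 at
      \<open>l = t\<close> in place of \<open>ks (Suc t)\<close>.\<close>
    have *: "int (card (K \<inter> {block_start ns l..<block_start ns (Suc l)})) =
        ks l - (if l < t then ks (Suc l) else 0)" if K: "K \<in> pivot_type t ks ns 1" for K
    proof -
      have "K \<subseteq> ?A"
        using K by (simp add: pivot_type_def)
      then have "card (K \<inter> {block_start ns l..}) =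
          card (K \<inter> {block_start ns l..<block_start ns (Suc l)}) +
          card (K \<inter> {block_start ns (Suc l)..})"
        by (rule card_Int_block) (simp add: block_start_mono)
      moreover have "int (card (K \<inter> {block_start ns l..})) = ks l"
        using K True by (simp add: pivot_type_def)
      moreover have "int (card (K \<inter> {block_start ns (Suc l)..})) = (if l < t then ks (Suc l) else 0)"
      proof (cases "l < t")
        case True
        then show ?thesis
          using K by (simp add: pivot_type_def)
      next
        case False
        then have "K \<inter> {block_start ns (Suc l)..} = {}"
          using \<open>l \<in> {1..t}\<close> \<open>K \<subseteq> ?A\<close> by (auto simp: block_start_top)
        then show ?thesis
          using False by simp
      qed
      ultimately show ?thesis
        by simp
    qed
    show ?thesis
      using *[OF J] *[OF J'] True by (simp add: block[OF JA(1)] block[OF JA(2)])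
  next
    case False
    then show ?thesis
      by (simp only: block[OF JA(1)] block[OF JA(2)] if_False)
  qed
  have "image_mset (\<lambda>x. (?f x, x \<in> J)) (mset_set ?A) = image_mset (\<lambda>x. (?f x, x \<in> J')) (mset_set ?A)"
  proof (rule multiset_eqI)
    fix y :: "nat \<times> bool"
    obtain l b where y: "y = (l, b)"
      by fastforce
    have *: "card {x \<in> ?A. (?f x, x \<in> K) = y} = (if b then card {x \<in> K. ?f x = l}
        else card {x \<in> ?A. ?f x = l} - card {x \<in> K. ?f x = l})"
      if K: "K \<in> pivot_type t ks ns 1" for K
    proof (cases b)
      case True
      have "{x \<in> ?A. (?f x, x \<in> K) = y} = {x \<in> K. ?f x = l}"
        using K True y by (auto simp: pivot_type_def)
      then show ?thesis
        using True by simp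
    next
      case False
      have "K \<subseteq> ?A"
        using K by (simp add: pivot_type_def)
      then have "{x \<in> K. ?f x = l} \<subseteq> {x \<in> ?A. ?f x = l}" "finite {x \<in> K. ?f x = l}"
        by (auto intro: finite_subset)
      moreover have "{x \<in> ?A. (?f x, x \<in> K) = y} = {x \<in> ?A. ?f x = l} - {x \<in> K. ?f x = l}"
        using False y by auto
      ultimately show ?thesis
        using False by (simp add: card_Diff_subset)
    qed
    show "count (image_mset (\<lambda>x. (?f x, x \<in> J)) (mset_set ?A)) y =
        count (image_mset (\<lambda>x. (?f x, x \<in> J')) (mset_set ?A)) y"
      by (simp only: count_image_mset_eq_card_vimage finite_atLeastLessThan *[OF J] *[OF J'] fib)
  qed
  then obtain p where "p permutes ?A" "\<forall>x\<in>?A. (?f x, x \<in> J) = (?f (p x), p x \<in> J')"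
    by (rule image_mset_eq_implies_permutes[OF finite_atLeastLessThan])
  then show thesis
    by (intro that[of p]) auto
qed

section \<open>The action of block triangular matrices on row vectors and subspaces\<close>

lemma row_mult_carrier: "T \<in> carrier_mat n n \<Longrightarrow> row_mult x T \<in> carrier_vec n"
  by (simp add: row_mult_def)

lemma row_mult_index:
  assumes "T \<in> carrier_mat n n" "x \<in> carrier_vec n" "j < n"
  shows "row_mult x T $ j = (\<Sum>i = 0..<n. x $ i * T $$ (i, j))"
  using assms by (simp add: row_mult_def scalar_prod_def)

lemma row_mult_add:
  assumes "T \<in> carrier_mat n n" "x \<in> carrier_vec n" "y \<in> carrier_vec n"
  shows "row_mult (x + y) T = row_mult x T + row_mult y T"
  using assms by (intro eq_vecI) (auto simp: row_mult_def add_scalar_prod_distrib[of _ n])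

lemma row_mult_smult:
  assumes "T \<in> carrier_mat n n" "x \<in> carrier_vec n"
  shows "row_mult (c \<cdot>\<^sub>v x) T = c \<cdot>\<^sub>v row_mult x T"
  using assms by (intro eq_vecI) (auto simp: row_mult_def)

lemma row_mult_zero:
  assumes "T \<in> carrier_mat n n"
  shows "row_mult (0\<^sub>v n) T = (0\<^sub>v n :: 'a :: field vec)"
  using assms by (intro eq_vecI) (auto simp: row_mult_def)

lemma row_mult_eq_transpose:
  fixes T :: "'a :: field mat"
  assumes "T \<in> carrier_mat n n" "x \<in> carrier_vec n"
  shows "row_mult x T = transpose_mat T *\<^sub>v x"
  using assms by (intro eq_vecI) (auto simp: row_mult_def intro: comm_scalar_prod[of _ n])

text \<open>Multiplication by the transpose of an inverse \<open>B\<close> undoes the row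
  action.\<close>

lemma inj_on_row_mult:
  fixes T :: "'a :: field mat"
  assumes T: "T \<in> carrier_mat n n" "invertible_mat T"
  shows "inj_on (\<lambda>x. row_mult x T) (carrier_vec n)"
proof -
  obtain B where B: "T * B = 1\<^sub>m n" "B * T = 1\<^sub>m (dim_row B)"
    using T by (auto simp: invertible_mat_def inverts_mat_def)
  \<comment> \<open>\<open>invertible_mat\<close> does not fix the shape of \<open>B\<close>; it is
    read off from the two products.\<close>
  have "dim_col B = n"
    using arg_cong[OF B(1), of dim_col] by simp
  moreover have "dim_row B = n"
    using arg_cong[OF B(2), of dim_col] T by simp
  ultimately have Bc: "B \<in> carrier_mat n n"
    by auto
  have "transpose_mat B *\<^sub>v row_mult x T = x" if "x \<in> carrier_vec n" for x
  proof -
    have "transpose_mat B *\<^sub>v row_mult x T = (transpose_mat B * transpose_mat T) *\<^sub>v x"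
      using that T Bc by (simp add: row_mult_eq_transpose assoc_mult_mat_vec[of _ n n _ n])
    also have "transpose_mat B * transpose_mat T = 1\<^sub>m n"
      using transpose_mult[OF T(1) Bc] B(1) by simp
    finally show ?thesis
      using that by simp
  qed
  then show ?thesis
    by (rule inj_on_inverseI)
qed

lemma subspace_mult_subspace:
  fixes T :: "'a :: field mat"
  assumes T: "T \<in> carrier_mat n n" and P: "P \<in> vec_subspaces n"
  shows "subspace_mult T P \<in> vec_subspaces n"
proof -
  note P = vec_subspacesD[OF P]
  have c: "x \<in> carrier_vec n" if "x \<in> P" for x
    using that P(1) by auto
  have "row_mult x T + row_mult y T \<in> subspace_mult T P" if "x \<in> P" "y \<in> P" for x y
    using that P(3) c T by (simp add: subspace_mult_def flip: row_mult_add)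
  moreover have "d \<cdot>\<^sub>v row_mult x T \<in> subspace_mult T P" if "x \<in> P" for x d
    using that P(4) c T by (simp add: subspace_mult_def flip: row_mult_smult)
  moreover have "0\<^sub>v n \<in> subspace_mult T P"
    using P(2) T unfolding subspace_mult_def by (metis image_eqI row_mult_zero)
  ultimately show ?thesis
    using row_mult_carrier[OF T] by (auto simp: mem_vec_subspaces_iff subspace_mult_def)
qed

text \<open>In each product \<open>x $ r * T $$ (r, c)\<close> with \<open>c\<close> before block
  \<open>i\<close>, either \<open>r\<close> also lies before block \<open>i\<close>, where
  \<open>x\<close> vanishes, or \<open>r\<close> lies in block \<open>i\<close> or later, where
  \<open>T\<close> vanishes in column \<open>c\<close>.\<close>

lemma subspace_mult_tail:
  fixes T :: "'a :: field mat"
  assumes T: "T \<in> carrier (singular_GL t ns)" and i: "1 \<le> i" "i \<le> t"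
  shows "subspace_mult T (tail_space (total_dim t ns) (block_start ns i)) \<subseteq>
    tail_space (total_dim t ns) (block_start ns i)"
proof
  let ?n = "total_dim t ns" and ?s = "block_start ns i"
  have Tc: "T \<in> carrier_mat ?n ?n" and but: "block_upper_triangular t ns T"
    using T by (auto simp: singular_GL_def)
  fix y assume "y \<in> subspace_mult T (tail_space ?n ?s)"
  then obtain x where y: "y = row_mult x T" and x: "x \<in> tail_space ?n ?s"
    by (auto simp: subspace_mult_def)
  have "y $ c = 0" if c: "c < ?s" "c < ?n" for c
  proof -
    have "x $ r * T $$ (r, c) = 0" if r: "r < ?n" for r
    proof (cases "r < ?s")
      case True
      then show ?thesis
        using x r by (simp add: tail_space_def)
    next
      case False
      note br = block_index_bounds[OF r] and bc = block_index_bounds[OF c(2)]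
      have "block_index ns c < i"
        using block_start_mono[of i "block_index ns c" ns] bc(3) c(1) by (cases "i \<le> block_index ns c") auto
      moreover have "i \<le> block_index ns r"
        using block_start_mono[of "Suc (block_index ns r)" i ns] br(4) False
        by (cases "i \<le> block_index ns r") auto
      ultimately have "T $$ (r, c) = 0"
        using but[unfolded block_upper_triangular_def, rule_format,
            of "block_index ns r" "block_index ns c" r c] br bc by simp
      then show ?thesis
        by simp
    qed
    then have "(\<Sum>r = 0..<?n. x $ r * T $$ (r, c)) = 0"
      by (intro sum.neutral) simp
    then show ?thesis
      using x row_mult_index[OF Tc _ c(2), of x] by (simp add: y tail_space_def)
  qed
  then show "y \<in> tail_space ?n ?s"
    using row_mult_carrier[OF Tc, of x] by (simp add: tail_space_def y)
qed

text \<open>\<open>T\<close> is injective and maps each flag space onto itself, so the action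
  commutes with intersecting with the flag and preserves the sizes of the intersections. These sizes
  determine the pivot counts.\<close>

lemma subspace_mult_type:
  fixes T :: "'a :: {field, finite} mat"
  assumes T: "T \<in> carrier (singular_GL t ns)" and P: "P \<in> subspaces_of_type t ks ns" and t: "t \<ge> 1"
  shows "subspace_mult T P \<in> subspaces_of_type t ks ns"
proof -
  let ?n = "total_dim t ns"
  have Tc: "T \<in> carrier_mat ?n ?n" and Ti: "invertible_mat T"
    using T by (auto simp: singular_GL_def)
  note inj = inj_on_row_mult[OF Tc Ti]
  have card: "card (subspace_mult T Q) = card Q" if "Q \<subseteq> carrier_vec ?n" for Q
    unfolding subspace_mult_def by (rule card_image) (rule inj_on_subset[OF inj that])
  have Ps: "P \<in> vec_subspaces ?n"
    using P by (simp add: subspaces_of_type_def)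
  note PT = subspace_mult_subspace[OF Tc Ps]
  have "card (pivots ?n (subspace_mult T P) \<inter> {block_start ns i..}) =
      card (pivots ?n P \<inter> {block_start ns i..})" if i: "1 \<le> i" "i \<le> t" for i
  proof -
    let ?E = "tail_space ?n (block_start ns i) :: 'a vec set"
    have E: "?E \<in> vec_subspaces ?n" "?E \<subseteq> carrier_vec ?n" "finite ?E"
      using finite_vec_subspace[OF tail_space_subspace]
      by (auto simp: tail_space_subspace vec_subspacesD(1)[OF tail_space_subspace, THEN subsetD])
    \<comment> \<open>An injective map of a finite set into itself is onto.\<close>
    have "subspace_mult T ?E = ?E"
      using subspace_mult_tail[OF T i] card[OF E(2)] E(3) by (intro card_subset_eq)
    then have "subspace_mult T P \<inter> ?E = subspace_mult T P \<inter> subspace_mult T ?E"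
      by simp
    also have "\<dots> = subspace_mult T (P \<inter> ?E)"
      unfolding subspace_mult_def
      by (rule inj_on_image_Int[OF inj, symmetric]) (use vec_subspacesD(1)[OF Ps] E in auto)
    finally have "card (subspace_mult T P \<inter> ?E) = card (P \<inter> ?E)"
      using card[of "P \<inter> ?E"] E(2) by auto
    then have "CARD('a) ^ card (pivots ?n (subspace_mult T P \<inter> ?E)) =
        CARD('a) ^ card (pivots ?n (P \<inter> ?E))"
      using card_eq_power_pivots[OF vec_subspaces_Int[OF PT E(1)]]
        card_eq_power_pivots[OF vec_subspaces_Int[OF Ps E(1)]] by simp
    then have "card (pivots ?n (subspace_mult T P \<inter> ?E)) = card (pivots ?n (P \<inter> ?E))"
      using CARD_field_ge_2[where 'a = 'a] by (simp add: power_inject_exp)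
    then show ?thesis
      using vec_subspacesD(1)[OF Ps] vec_subspacesD(1)[OF PT] by (simp add: pivots_Int_tail)
  qed
  then show ?thesis
    using P PT unfolding subspaces_of_type_eq[OF t]
    by (auto simp: pivot_type_def dest!: pivots_less[THEN subsetD])
qed

section \<open>Coordinate subspaces as representatives of the orbits\<close>

definition coordinate_subspace :: "nat \<Rightarrow> nat set \<Rightarrow> 'a :: field vec set" where
  "coordinate_subspace n J = {v \<in> carrier_vec n. \<forall>i<n. i \<notin> J \<longrightarrow> v $ i = 0}"

lemma coordinate_subspace_subspace: "coordinate_subspace n J \<in> vec_subspaces n"
  by (auto simp: mem_vec_subspaces_iff coordinate_subspace_def)

lemma pivots_coordinate_subspace:
  assumes "J \<subseteq> {0..<n}"
  shows "pivots n (coordinate_subspace n J :: 'a :: field vec set) = J"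
proof (intro equalityI subsetI)
  fix j assume "j \<in> pivots n (coordinate_subspace n J :: 'a vec set)"
  then show "j \<in> J"
    by (auto simp: pivots_def coordinate_subspace_def)
next
  fix j assume j: "j \<in> J"
  then have "unit_vec n j \<in> (coordinate_subspace n J :: 'a vec set)"
    using assms by (auto simp: coordinate_subspace_def)
  then show "j \<in> pivots n (coordinate_subspace n J :: 'a vec set)"
    using j assms unfolding pivots_def by force
qed

text \<open>The sum is written by coordinates to match \<open>row_mult_index\<close>, which presents
  a row vector times a matrix as a combination of the matrix rows.\<close>

lemma vec_subspace_sum:
  fixes P :: "'a :: field vec set" and k :: nat
  assumes P: "P \<in> vec_subspaces n" and f: "\<And>i. i < k \<Longrightarrow> f i \<in> P"
  shows "vec n (\<lambda>j. \<Sum>i = 0..<k. f i $ j) \<in> P"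
  using f
proof (induction k)
  case 0
  then show ?case
    using vec_subspacesD(2)[OF P] by (simp add: zero_vec_def)
next
  case (Suc k)
  have "f k \<in> carrier_vec n"
    using Suc.prems vec_subspacesD(1)[OF P] by auto
  then have "vec n (\<lambda>j. \<Sum>i = 0..<Suc k. f i $ j) = vec n (\<lambda>j. \<Sum>i = 0..<k. f i $ j) + f k"
    by (intro eq_vecI) auto
  then show ?case
    using Suc vec_subspacesD(3)[OF P] by simp
qed

lemma invertible_mat_if_det_nonzero:
  fixes T :: "'a :: field mat"
  assumes T: "T \<in> carrier_mat n n" and "det T \<noteq> 0"
  shows "invertible_mat T"
proof -
  have "T \<in> Units (ring_mat TYPE('a) n ())"
    using assms by (rule det_non_zero_imp_unit)
  then obtain B where "B \<in> carrier_mat n n" "T * B = 1\<^sub>m n" "B * T = 1\<^sub>m n"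
    by (auto simp: Units_def ring_mat_simps)
  then show ?thesis
    using T by (auto simp: invertible_mat_def inverts_mat_def square_mat.simps)
qed

text \<open>
  Row \<open>r\<close> of \<open>T\<close> is a vector with leading entry 1 at position \<open>p r\<close>, taken from \<open>P\<close> if
  \<open>p r\<close> is a pivot of \<open>P\<close>; undoing the row permutation leaves an upper unitriangular matrix.
\<close>

lemma ex_subspace_mult_eq:
  fixes P :: "'a :: {field, finite} vec set"
  assumes P: "P \<in> vec_subspaces (total_dim t ns)"
    and J: "J \<subseteq> {0..<total_dim t ns}"
    and p: "p permutes {0..<total_dim t ns}"
    and pJ: "\<And>r. r < total_dim t ns \<Longrightarrow> p r \<in> pivots (total_dim t ns) P \<longleftrightarrow> r \<in> J"
    and pb: "\<And>r. r < total_dim t ns \<Longrightarrow> block_index ns (p r) = block_index ns r"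
  shows "\<exists>T\<in>carrier (singular_GL t ns). subspace_mult T (coordinate_subspace (total_dim t ns) J) = P"
proof -
  let ?n = "total_dim t ns"
  \<comment> \<open>Off the pivots any vector with leading entry 1 at \<open>j\<close> serves; the
    unit vector is taken.\<close>
  have "\<exists>u. u \<in> tail_space ?n j \<and> u $ j = 1 \<and> (j \<in> pivots ?n P \<longrightarrow> u \<in> P)" if "j < ?n" for j
  proof (cases "j \<in> pivots ?n P")
    case True
    then show ?thesis
      using pivot_vector[OF P True] by metis
  next
    case False
    then show ?thesis
      using that by (intro exI[of _ "unit_vec ?n j"]) (auto simp: tail_space_def)
  qed
  then obtain b :: "nat \<Rightarrow> 'a vec" where
    b: "\<And>j. j < ?n \<Longrightarrow> b j \<in> tail_space ?n j" "\<And>j. j < ?n \<Longrightarrow> b j $ j = 1"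
      "\<And>j. j \<in> pivots ?n P \<Longrightarrow> j < ?n \<Longrightarrow> b j \<in> P"
    by metis
  define U where "U = mat ?n ?n (\<lambda>(r, c). b r $ c)"
  define T where "T = mat ?n ?n (\<lambda>(r, c). U $$ (p r, c))"
  have U: "U \<in> carrier_mat ?n ?n" and Tc: "T \<in> carrier_mat ?n ?n"
    by (auto simp: U_def T_def)
  have pn: "p r < ?n" if "r < ?n" for r
    using permutes_in_image[OF p, of r] that by simp
  have T_index: "T $$ (r, c) = b (p r) $ c" if "r < ?n" "c < ?n" for r c
    using that pn by (simp add: T_def U_def)
  have "upper_triangular U"
    using b(1) by (auto simp: U_def upper_triangular_def tail_space_def)
  moreover have "diag_mat U = replicate ?n 1"
    using b(2) by (intro nth_equalityI) (auto simp: diag_mat_def U_def)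
  ultimately have "det U = 1"
    using det_upper_triangular[OF _ U] by (simp add: prod_list_replicate)
  \<comment> \<open>Permuting the rows changes the determinant by a sign only.\<close>
  then have "det T \<noteq> 0"
    using det_permute_rows[OF U p] by (simp add: T_def sign_def)
  then have Ti: "invertible_mat T"
    using Tc by (rule invertible_mat_if_det_nonzero[rotated])
  have "block_upper_triangular t ns T"
    unfolding block_upper_triangular_def
  proof (intro ballI impI)
    fix i j r c assume ij: "i \<in> {1..t}" "j \<in> {1..t}" "j < i"
      and r: "r \<in> {block_start ns i..<block_start ns (i + 1)}"
      and c: "c \<in> {block_start ns j..<block_start ns (j + 1)}"
    have "block_start ns (Suc i) \<le> ?n" "block_start ns (Suc j) \<le> block_start ns i"
      using ij by (auto intro: block_start_le_total_dim block_start_mono)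
    then have rc: "r < ?n" "c < ?n" "c < block_start ns i"
      using r c by auto
    \<comment> \<open>\<open>p\<close> keeps \<open>r\<close> in block \<open>i\<close>, so the
      leading entry of row \<open>r\<close>, at \<open>p r\<close>, lies at or after the start of
      that block and hence behind column \<open>c\<close>.\<close>
    have "block_index ns (p r) = i"
      using pb[OF rc(1)] block_index_eqI[of i ns r] ij r by simp
    then have "block_start ns i \<le> p r"
      using block_index_bounds(3)[OF pn[OF rc(1)]] by simp
    then show "T $$ (r, c) = 0"
      using rc b(1)[OF pn[OF rc(1)]] by (simp add: T_index tail_space_def)
  qed
  then have T: "T \<in> carrier (singular_GL t ns)"
    using Tc Ti by (simp add: singular_GL_def)
  let ?C = "coordinate_subspace ?n J :: 'a vec set"
  have "subspace_mult T ?C \<subseteq> P"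
  proof
    fix y assume "y \<in> subspace_mult T ?C"
    then obtain x where x: "x \<in> ?C" and y: "y = row_mult x T"
      by (auto simp: subspace_mult_def)
    then have xc: "x \<in> carrier_vec ?n"
      by (simp add: coordinate_subspace_def)
    have bc: "b (p r) \<in> carrier_vec ?n" if "r < ?n" for r
      using b(1)[OF pn[OF that]] by (simp add: tail_space_def)
    \<comment> \<open>Coordinates of \<open>x\<close> outside \<open>J\<close> vanish, so only rows
      taken from \<open>P\<close> contribute.\<close>
    have "x $ r \<cdot>\<^sub>v b (p r) \<in> P" if r: "r < ?n" for r
    proof (cases "r \<in> J")
      case True
      then show ?thesis
        using b(3) pJ r pn vec_subspacesD(4)[OF P] by simp
    next
      case False
      then have "x $ r \<cdot>\<^sub>v b (p r) = 0\<^sub>v ?n"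
        using x r bc[OF r] by (intro eq_vecI) (auto simp: coordinate_subspace_def)
      then show ?thesis
        using vec_subspacesD(2)[OF P] by simp
    qed
    then have "vec ?n (\<lambda>c. \<Sum>r = 0..<?n. (x $ r \<cdot>\<^sub>v b (p r)) $ c) \<in> P"
      by (rule vec_subspace_sum[OF P])
    moreover have "y = vec ?n (\<lambda>c. \<Sum>r = 0..<?n. (x $ r \<cdot>\<^sub>v b (p r)) $ c)"
    proof (rule eq_vecI)
      fix c assume "c < dim_vec (vec ?n (\<lambda>c. \<Sum>r = 0..<?n. (x $ r \<cdot>\<^sub>v b (p r)) $ c))"
      then have c: "c < ?n"
        by simp
      have "(x $ r \<cdot>\<^sub>v b (p r)) $ c = x $ r * T $$ (r, c)" if "r < ?n" for r
        using bc[OF that] c that by (simp add: T_index)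
      then show "y $ c = vec ?n (\<lambda>c. \<Sum>r = 0..<?n. (x $ r \<cdot>\<^sub>v b (p r)) $ c) $ c"
        unfolding y row_mult_index[OF Tc xc c] using c by simp
    qed (use row_mult_carrier[OF Tc, of x] y in auto)
    ultimately show "y \<in> P"
      by simp
  qed
  \<comment> \<open>Equal sizes turn the inclusion into an equality; \<open>p\<close> matches
    \<open>J\<close> with the pivots of \<open>P\<close>.\<close>
  moreover have "card (subspace_mult T ?C) = card P"
  proof -
    have "?C \<subseteq> carrier_vec ?n"
      by (auto simp: coordinate_subspace_def)
    then have "card (subspace_mult T ?C) = card ?C"
      unfolding subspace_mult_def by (intro card_image inj_on_subset[OF inj_on_row_mult[OF Tc Ti]])
    also have "\<dots> = CARD('a) ^ card J"
      using card_eq_power_pivots[OF coordinate_subspace_subspace[of ?n J, where 'a = 'a]]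
      by (simp add: pivots_coordinate_subspace[OF J])
    also have "card J = card (pivots ?n P)"
    proof (rule bij_betw_same_card)
      have "p ` J = pivots ?n P"
      proof (intro equalityI subsetI)
        fix j assume j: "j \<in> pivots ?n P"
        then have "j \<in> p ` {0..<?n}"
          using pivots_less permutes_image[OF p] by blast
        then show "j \<in> p ` J"
          using j pJ by auto
      qed (use J pJ in auto)
      then show "bij_betw p J (pivots ?n P)"
        using permutes_inj_on[OF p] by (simp add: bij_betw_def)
    qed
    finally show ?thesis
      by (simp add: card_eq_power_pivots[OF P])
  qed
  ultimately have "subspace_mult T ?C = P"
    using finite_vec_subspace[OF P] by (intro card_subset_eq)
  then show ?thesis
    using T by blast
qed

text \<open>The pivot set \<open>J\<close> of any member provides a base point, since its coordinate
  subspace has the same type. Every member is reached from there by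
  \<open>ex_subspace_mult_eq\<close>, and the action never leaves the type.\<close>

lemma subspaces_of_type_orbit:
  assumes t: "t \<ge> 1" and ne: "(subspaces_of_type t ks ns :: 'a :: {field, finite} vec set set) \<noteq> {}"
  shows "(subspaces_of_type t ks ns :: 'a vec set set)
    \<in> orbits (singular_GL t ns) (vec_subspaces (total_dim t ns)) subspace_mult"
proof -
  let ?n = "total_dim t ns" and ?M = "subspaces_of_type t ks ns :: 'a vec set set"
  obtain J where J: "J \<in> pivot_type t ks ns 1"
    using ne by (auto simp: subspaces_of_type_eq[OF t])
  then have Jn: "J \<subseteq> {0..<?n}"
    by (simp add: pivot_type_def)
  let ?C = "coordinate_subspace ?n J :: 'a vec set"
  have C: "?C \<in> ?M"
    using J by (simp add: subspaces_of_type_eq[OF t] coordinate_subspace_subspace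
        pivots_coordinate_subspace[OF Jn])
  have "?M = orbit (singular_GL t ns) subspace_mult ?C"
  proof (intro equalityI subsetI)
    fix P assume "P \<in> ?M"
    then have P: "P \<in> vec_subspaces ?n" "pivots ?n P \<in> pivot_type t ks ns 1"
      by (simp_all add: subspaces_of_type_eq[OF t])
    obtain p where "p permutes {0..<?n}" "\<And>r. r < ?n \<Longrightarrow> p r \<in> pivots ?n P \<longleftrightarrow> r \<in> J"
      "\<And>r. r < ?n \<Longrightarrow> block_index ns (p r) = block_index ns r"
      using ex_block_permutation[OF J P(2)] by blast
    then show "P \<in> orbit (singular_GL t ns) subspace_mult ?C"
      using ex_subspace_mult_eq[OF P(1) Jn] unfolding orbit_def by blast
  next
    fix P assume "P \<in> orbit (singular_GL t ns) subspace_mult ?C"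
    then show "P \<in> ?M"
      using subspace_mult_type[OF _ C t] by (auto simp: orbit_def)
  qed
  then show ?thesis
    using coordinate_subspace_subspace unfolding orbits_def by blast
qed

theorem theorem2p1:
  fixes q t :: nat and ns :: "nat \<Rightarrow> nat" and ks :: "nat \<Rightarrow> int"
  assumes "CARD('a :: {field, finite}) = q"
    and "t \<ge> 1"
  shows "((subspaces_of_type t ks ns :: 'a vec set set) \<noteq> {} \<longleftrightarrow> admissible_type t ks ns) \<and>
    (admissible_type t ks ns \<longrightarrow>
       (subspaces_of_type t ks ns :: 'a vec set set)
         \<in> orbits (singular_GL t ns) (vec_subspaces (total_dim t ns)) subspace_mult \<and>
       rat_of_nat (card (subspaces_of_type t ks ns :: 'a vec set set)) =
         gauss_binomial q (ns t) (nat (ks t)) *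
         (\<Prod>j = 1..<t.
            rat_of_nat q powi
              ((ks j - ks (j + 1)) * (int (\<Sum>l = j + 1..t. ns l) - ks (j + 1))) *
            gauss_binomial q (ns j) (nat (ks j - ks (j + 1)))))"
proof -
  let ?M = "subspaces_of_type t ks ns :: 'a vec set set"
  let ?count = "gauss_binomial q (ns t) (nat (ks t)) *
    (\<Prod>j = 1..<t.
       rat_of_nat q powi ((ks j - ks (j + 1)) * (int (\<Sum>l = j + 1..t. ns l) - ks (j + 1))) *
       gauss_binomial q (ns j) (nat (ks j - ks (j + 1))))"
  have q: "q \<ge> 2"
    using CARD_field_ge_2[where 'a = 'a] assms(1) by simp
  have adm: "admissible_type t ks ns" if "?M \<noteq> {}"
    using that admissible_if_pivot_type[OF assms(2)] by (auto simp: subspaces_of_type_eq[OF assms(2)])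
  have card: "rat_of_nat (card ?M) = ?count" if "admissible_type t ks ns"
    using sum_pivot_type[OF that _ assms(2) q] card_subspaces_of_type[OF assms(2), of ks ns, where 'a = 'a]
      assms(1) by simp
  have "?M \<noteq> {}" if "admissible_type t ks ns"
  proof -
    \<comment> \<open>Admissibility puts each lower index between 0 and the upper one, so with
      \<open>q \<ge> 2\<close> no Gaussian factor vanishes.\<close>
    have "?count \<noteq> 0"
      using that q by (auto simp: admissible_type_def gauss_binomial_neq_0)
    then show ?thesis
      using card[OF that] by force
  qed
  then show ?thesis
    using adm card subspaces_of_type_orbit[OF assms(2)] by blast
qed

end
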